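(* Let $\mu>0$ and consider the planar (an)isotropic oscillator with Lagrangian $$L(x,y,\dot x,\dot y)=\tfrac12(\dot x^2+\dot y^2)-\Bigl(\tfrac{x^2}{2}+\mu^2\tfrac{y^2}{2}\Bigr)\quad\text{on }\mathbb R^2 .$$ For $k>0$ let $\gamma_k(t)=(0,a_k\cos(\mu t))$, with $a_k=\sqrt{2k/\mu^2}$, be the vertical brake orbit of energy $k$ and period $T_k=2\pi/\mu$. Then $$\iota^T(\gamma_k)=2\Bigl\lceil\frac1\mu\Bigr\rceil,\qquad \iota^E(\gamma_k)=2\Bigl\lceil\frac1\mu\Bigr\rceil+1,\qquad \iota_D(\gamma_k)=\Bigl\lceil\frac2\mu\Bigr\rceil .$$
   Context: With $T=T_k$: fixed-time action $\mathcal A^T(q)=\int_0^T L(q,\dot q)\,dt$. The fixed-time Morse index $\iota^T(\gamma)$ is the maximal dimension of a subspace of the space of $T$-periodic $H^1$ variations on which $d^2\mathcal A^T(\gamma)$ is negative definite; the Dirichlet index $\iota_D(\gamma)$ is the same with $H^1$ variations on $[0,T]$ vanishing at $t=0$ and $t=T$. Free-period functional: $\mathcal S_k(x,T)=T\int_0^1[L(x(s),x'(s)/T)+k]\,ds$ on $H^1(\mathbb R/\mathbb Z,\mathbb R^2)\times(0,+\infty)$. The orbit $\gamma$ corresponds to the critical point $(x,T)$, $x(s)=\gamma(Ts)$, and $\iota^E(\gamma)$ is the maximal dimension of a subspace of $H^1(\mathbb R/\mathbb Z,\mathbb R^2)\times\mathbb R$ on which $d^2\mathcal S_k(x,T)$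 is negative definite. *)

theory Defs
  imports "HOL-Analysis.Analysis" "HOL-Library.Function_Algebras"
begin

instantiation "fun" :: (type, real_vector) real_vector
begin

definition scaleR_fun :: "real \<Rightarrow> ('a \<Rightarrow> 'b) \<Rightarrow> 'a \<Rightarrow> 'b"
  where "scaleR_fun c f = (\<lambda>t. c *\<^sub>R f t)"

instance
  by standard (auto simp: scaleR_fun_def fun_eq_iff scaleR_add_right scaleR_add_left)

end


text \<open>
  Sobolev functions of class \<open>H\<^sup>1\<close> on \<open>[a, b]\<close>, given by their absolutely continuous
  representatives: \<open>w\<close> is a square integrable weak derivative of \<open>u\<close>.
\<close>

definition has_H1_deriv ::
    "(real \<Rightarrow> 'a::euclidean_space) \<Rightarrow> (real \<Rightarrow> 'a) \<Rightarrow> real \<Rightarrow> real \<Rightarrow> bool"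
  where "has_H1_deriv u w a b \<longleftrightarrow>
    w absolutely_integrable_on {a..b} \<and>
    (\<lambda>t. (norm (w t))\<^sup>2) integrable_on {a..b} \<and>
    (\<forall>t\<in>{a..b}. (w has_integral (u t - u a)) {a..t})"

text \<open>The choice below is unique up to a null set, so integrals do not depend on it.\<close>

definition weak_deriv :: "real \<Rightarrow> real \<Rightarrow> (real \<Rightarrow> 'a::euclidean_space) \<Rightarrow> real \<Rightarrow> 'a"
  where "weak_deriv a b u = (SOME w. has_H1_deriv u w a b)"

text \<open>\<open>H\<^sup>1(\<real>/T\<int>)\<close>, as periodic functions on the line.\<close>

definition H1_periodic :: "real \<Rightarrow> (real \<Rightarrow> 'a::euclidean_space) set"
  where "H1_periodic T = {u. (\<exists>w. has_H1_deriv u w 0 T) \<and> (\<forall>t. u (t + T) = u t)}"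

text \<open>
  \<open>H\<^sup>1\<close> functions on \<open>[0, T]\<close> vanishing at both end points. They are extended by zero to the
  line, so that distinct elements are distinct as functions on \<open>[0, T]\<close>; otherwise dimensions
  would be wrong.
\<close>

definition H1_Dirichlet :: "real \<Rightarrow> (real \<Rightarrow> 'a::euclidean_space) set"
  where "H1_Dirichlet T = {u. (\<exists>w. has_H1_deriv u w 0 T) \<and> u 0 = 0 \<and> u T = 0 \<and>
    (\<forall>t. t \<notin> {0..T} \<longrightarrow> u t = 0)}"


text \<open>The quadratic form \<open>v \<mapsto> d\<^sup>2F(x)[v, v]\<close>.\<close>

definition second_variation :: "('v::real_vector \<Rightarrow> real) \<Rightarrow> 'v \<Rightarrow> 'v \<Rightarrow> real"
  where "second_variation F x v = deriv (deriv (\<lambda>\<epsilon>. F (x + \<epsilon> *\<^sub>R v))) 0"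

text \<open>
  Supremum of the dimensions of the subspaces of \<open>V\<close> on which \<open>Q\<close> is negative definite. Only
  finite-dimensional subspaces are listed (\<open>dim\<close> is a dummy value on the others); an
  infinite-dimensional one contains some of every finite dimension, so it makes the index \<open>\<infinity>\<close>.
\<close>

definition morse_index :: "'v::real_vector set \<Rightarrow> ('v \<Rightarrow> real) \<Rightarrow> enat"
  where "morse_index V Q = Sup {enat (dim W) | W.
    subspace W \<and> (\<exists>B. finite B \<and> span B = W) \<and> W \<subseteq> V \<and> (\<forall>v\<in>W. v \<noteq> 0 \<longrightarrow> Q v < 0)}"


definition action :: "('a::euclidean_space \<Rightarrow> 'a \<Rightarrow> real) \<Rightarrow> real \<Rightarrow> (real \<Rightarrow> 'a) \<Rightarrow> real"
  where "action L T q = integral {0..T} (\<lambda>t. L (q t) (weak_deriv 0 T q t))"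

definition free_period_action ::
    "('a::euclidean_space \<Rightarrow> 'a \<Rightarrow> real) \<Rightarrow> real \<Rightarrow> (real \<Rightarrow> 'a) \<times> real \<Rightarrow> real"
  where "free_period_action L k = (\<lambda>(x, T).
    T * integral {0..1} (\<lambda>s. L (x s) (weak_deriv 0 1 x s /\<^sub>R T) + k))"

definition fixed_time_index ::
    "('a::euclidean_space \<Rightarrow> 'a \<Rightarrow> real) \<Rightarrow> real \<Rightarrow> (real \<Rightarrow> 'a) \<Rightarrow> enat"
  where "fixed_time_index L T \<gamma> =
    morse_index (H1_periodic T) (second_variation (action L T) \<gamma>)"

definition Dirichlet_index ::
    "('a::euclidean_space \<Rightarrow> 'a \<Rightarrow> real) \<Rightarrow> real \<Rightarrow> (real \<Rightarrow> 'a) \<Rightarrow> enat"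
  where "Dirichlet_index L T \<gamma> =
    morse_index (H1_Dirichlet T) (second_variation (action L T) \<gamma>)"

text \<open>
  The functional lives on the open set \<open>T > 0\<close>, whose tangent space is the whole product.
\<close>

definition free_period_index ::
    "('a::euclidean_space \<Rightarrow> 'a \<Rightarrow> real) \<Rightarrow> real \<Rightarrow> real \<Rightarrow> (real \<Rightarrow> 'a) \<Rightarrow> enat"
  where "free_period_index L k T \<gamma> =
    morse_index (H1_periodic 1 \<times> UNIV)
      (second_variation (free_period_action L k) (\<lambda>s. \<gamma> (T * s), T))"


definition oscillator_lagrangian :: "real \<Rightarrow> real \<times> real \<Rightarrow> real \<times> real \<Rightarrow> real"
  where "oscillator_lagrangian \<mu> = (\<lambda>(x, y) (vx, vy).
    (1/2) * (vx\<^sup>2 + vy\<^sup>2) - (x\<^sup>2 / 2 + \<mu>\<^sup>2 * (y\<^sup>2 / 2)))"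

definition vertical_amplitude :: "real \<Rightarrow> real \<Rightarrow> real"
  where "vertical_amplitude \<mu> k = sqrt (2 * k / \<mu>\<^sup>2)"

definition vertical_orbit :: "real \<Rightarrow> real \<Rightarrow> real \<Rightarrow> real \<times> real"
  where "vertical_orbit \<mu> k t = (0, vertical_amplitude \<mu> k * cos (\<mu> * t))"

definition vertical_period :: "real \<Rightarrow> real"
  where "vertical_period \<mu> = 2 * pi / \<mu>"

end

(*
  The second variations are quadratic forms int |v'|^2 - A^2 x^2 - B^2 y^2, and their index is
  bounded above without Fourier series: if u changes sign across an interval of length h, that is
  u(b) = - u(a), then int u'^2 >= (pi/h)^2 int u^2. Requiring u to alternate in sign at n
  equidistant nodes hence makes the form nonnegative as soon as A <= n pi / tau. On the circle,
  n = 2 m such nodes cost only 2 m - 1 linear conditions, which is exactly the number of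
  trigonometric modes of degree less than m; for Dirichlet conditions it suffices that u vanishes
  at the n - 1 interior nodes. The trigonometric modes themselves give the lower bounds. In the
  free-period problem, fixing the period is one further linear condition, and changing it together
  with the first vertical cosine mode is one further negative direction.
*)
theory Submission
  imports Defs
begin

section \<open>Absolutely continuous functions and Wirtinger inequalities\<close>

text \<open>The vertical part is resonant: \<open>B * \<tau> = 2 * pi\<close> in all three problems.
  On the circle only the vertical constant is a negative direction, and the first harmonics are
  null. With Dirichlet conditions only the half-wave sine is negative, and the next sine is null.
  Two half-period pieces have critical value exactly 2 pi / \<tau>, so one vertical condition at
  \<tau> / 2 suffices. This one vertical dimension completes 2 m - 1 to 2 m on the circle and n - 1
  to n with Dirichlet conditions. Horizontal modes may be resonant too, namely when 1 / \<mu> or 2 /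
  \<mu> is an integer. Null modes do not count, which is why ceilings appear, and the upper bound
  must then hold with equality in A <= n pi / \<tau>. The Wirtinger constant therefore has to be
  sharp. It comes from completing a square with a solution of a Riccati equation, which needs
  integration by parts for functions whose derivatives are merely integrable.\<close>

definition abs_cont_deriv :: "(real \<Rightarrow> real) \<Rightarrow> (real \<Rightarrow> real) \<Rightarrow> real \<Rightarrow> real \<Rightarrow> bool"
  where "abs_cont_deriv u w a b \<longleftrightarrow>
    w absolutely_integrable_on {a..b} \<and> (\<forall>t\<in>{a..b}. (w has_integral (u t - u a)) {a..t})"

lemma abs_cont_deriv_has_integral:
  assumes "abs_cont_deriv u w a b" "a \<le> s" "s \<le> t" "t \<le> b"
  shows "(w has_integral (u t - u s)) {s..t}"
proof -
  have at: "(w has_integral (u t - u a)) {a..t}" and as: "(w has_integral (u s - u a)) {a..s}"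
    using assms by (auto simp: abs_cont_deriv_def)
  have i: "w integrable_on {s..t}"
    using at assms by (auto intro: integrable_subinterval_real)
  have "integral {a..s} w + integral {s..t} w = integral {a..t} w"
    using at assms by (intro Henstock_Kurzweil_Integration.integral_combine) auto
  then have "integral {s..t} w = u t - u s"
    using at as by (simp add: integral_unique)
  then show ?thesis
    using i by (simp add: has_integral_integrable_integral)
qed

lemma abs_cont_deriv_subinterval:
  assumes "abs_cont_deriv u w a b" "a \<le> s" "t \<le> b"
  shows "abs_cont_deriv u w s t"
proof -
  have "w absolutely_integrable_on {s..t}"
    using assms by (auto simp: abs_cont_deriv_def intro: absolutely_integrable_on_subinterval)
  then show ?thesis
    using abs_cont_deriv_has_integral[OF assms(1)] assms by (auto simp: abs_cont_deriv_def)
qed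

lemma abs_cont_deriv_continuous:
  assumes "abs_cont_deriv u w a b"
  shows "continuous_on {a..b} u"
proof -
  have "w integrable_on {a..b}"
    using assms by (auto simp: abs_cont_deriv_def set_lebesgue_integral_eq_integral(1))
  then have "continuous_on {a..b} (\<lambda>t. u a + integral {a..t} w)"
    by (intro continuous_intros indefinite_integral_continuous_1)
  then show ?thesis
  proof (rule continuous_on_eq)
    fix x assume "x \<in> {a..b}"
    then have "(w has_integral (u x - u a)) {a..x}"
      using assms by (auto simp: abs_cont_deriv_def)
    then show "u a + integral {a..x} w = u x"
      by (simp add: integral_unique)
  qed
qed

lemma absolutely_integrable_continuous_mult:
  fixes g w :: "real \<Rightarrow> real"
  assumes "continuous_on {a..b} g" "w absolutely_integrable_on {a..b}"
  shows "(\<lambda>t. g t * w t) absolutely_integrable_on {a..b}"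
    and "(\<lambda>t. w t * g t) absolutely_integrable_on {a..b}"
proof -
  show "(\<lambda>t. g t * w t) absolutely_integrable_on {a..b}"
    using assms
    by (intro absolutely_integrable_bounded_measurable_product_real
        continuous_imp_measurable_on_sets_lebesgue compact_imp_bounded compact_continuous_image) auto
  then show "(\<lambda>t. w t * g t) absolutely_integrable_on {a..b}"
    by (simp add: mult.commute)
qed

lemma abs_cont_deriv_smooth:
  assumes "\<And>t. t \<in> {a..b} \<Longrightarrow> (g has_real_derivative g' t) (at t)" "continuous_on {a..b} g'"
  shows "abs_cont_deriv g g' a b"
  unfolding abs_cont_deriv_def
proof (intro conjI ballI)
  show "g' absolutely_integrable_on {a..b}"
    by (rule absolutely_integrable_continuous_real) fact
  fix t assume t: "t \<in> {a..b}"
  have "(g has_vector_derivative g' x) (at x within {a..t})" if "x \<in> {a..t}" for x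
    using assms(1)[of x] that t
    by (auto simp: has_real_derivative_iff_has_vector_derivative intro: has_vector_derivative_at_within)
  then show "(g' has_integral g t - g a) {a..t}"
    using t by (intro fundamental_theorem_of_calculus) auto
qed

section \<open>Integration by parts for absolutely continuous functions\<close>

lemma constant_if_increments_small:
  fixes f g :: "real \<Rightarrow> real"
  assumes "a \<le> b"
    and small: "\<And>\<epsilon>. \<epsilon> > 0 \<Longrightarrow> \<exists>\<delta>>0. \<forall>s t. a \<le> s \<and> s \<le> t \<and> t \<le> b \<and> t - s < \<delta> \<longrightarrow>
      \<bar>f t - f s\<bar> \<le> \<epsilon> * (g t - g s)"
  shows "f b = f a"
proof -
  \<comment> \<open>Cut [a, b] into n equal pieces shorter than \<delta>. The bounds on the pieces
    add up, and on the right the increments of \<open>g\<close> telescope, so the total does not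
    depend on n. Letting \<epsilon> tend to 0 then gives the claim.\<close>
  have bound: "\<bar>f b - f a\<bar> \<le> \<epsilon> * (g b - g a)" if "\<epsilon> > 0" for \<epsilon>
  proof -
    obtain \<delta> where "\<delta> > 0" and \<delta>: "\<And>s t. \<lbrakk>a \<le> s; s \<le> t; t \<le> b; t - s < \<delta>\<rbrakk> \<Longrightarrow>
        \<bar>f t - f s\<bar> \<le> \<epsilon> * (g t - g s)"
      using small[OF \<open>\<epsilon> > 0\<close>] by metis
    obtain n :: nat where n: "(b - a) / \<delta> < real n"
      using reals_Archimedean2 by blast
    moreover have "0 \<le> (b - a) / \<delta>"
      using \<open>a \<le> b\<close> \<open>\<delta> > 0\<close> by simp
    ultimately have "real n > 0"
      by linarith
    define x where "x i = a + real i * ((b - a) / real n)" for i :: nat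
    have step: "x (Suc i) = x i + (b - a) / real n" for i
      by (simp add: x_def distrib_right add_divide_distrib)
    have h: "0 \<le> (b - a) / real n" "(b - a) / real n < \<delta>"
      using n \<open>\<delta> > 0\<close> \<open>real n > 0\<close> \<open>a \<le> b\<close> by (auto simp: field_simps)
    have ax: "a \<le> x i" for i
      using mult_nonneg_nonneg[OF of_nat_0_le_iff h(1), of i] by (simp add: x_def)
    have xb: "x i \<le> b" if "i \<le> n" for i
    proof -
      have "real i * ((b - a) / real n) \<le> real n * ((b - a) / real n)"
        using that h(1) by (intro mult_right_mono) auto
      then show ?thesis
        using \<open>real n > 0\<close> by (simp add: x_def)
    qed
    have "\<bar>f (x i) - f a\<bar> \<le> \<epsilon> * (g (x i) - g a)" if "i \<le> n" for i
      using that
    proof (induction i)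
      case 0
      then show ?case by (simp add: x_def)
    next
      case (Suc i)
      have "\<bar>f (x (Suc i)) - f (x i)\<bar> \<le> \<epsilon> * (g (x (Suc i)) - g (x i))"
        by (rule \<delta>) (use ax xb[of "Suc i"] Suc.prems h step in auto)
      then show ?case
        using Suc by (simp add: algebra_simps)
    qed
    from this[of n] show ?thesis
      using \<open>real n > 0\<close> by (simp add: x_def)
  qed
  have "\<bar>f b - f a\<bar> \<le> e" if "e > 0" for e
  proof -
    define M where "M = \<bar>g b - g a\<bar> + 1"
    have "\<bar>f b - f a\<bar> \<le> e / M * (g b - g a)"
      using that by (intro bound) (simp add: M_def)
    also have "\<dots> \<le> e / M * M"
      using that by (intro mult_left_mono) (auto simp: M_def)
    also have "\<dots> = e"
      by (simp add: M_def)
    finally show ?thesis .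
  qed
  then show ?thesis
    by (metis abs_ge_zero abs_le_zero_iff eq_iff_diff_eq_0 field_le_epsilon add_0)
qed

text \<open>On a short interval [s, t] the increment of \<open>u * v\<close> is exactly the integral
  of \<open>w r * v t + u s * z r\<close>, because \<open>v t\<close> and \<open>u s\<close> are
  constants there. Replacing them by \<open>v r\<close> and \<open>u r\<close> costs at most
  \<epsilon> (|w| + |z|), by uniform continuity. The difference \<open>f\<close> between the product
  and the candidate integral thus has increments bounded by \<epsilon> times those of the integral
  of |w| + |z|, and must be constant.\<close>

lemma abs_cont_deriv_mult_has_integral:
  assumes "a \<le> b" and u: "abs_cont_deriv u w a b" and v: "abs_cont_deriv v z a b"
  shows "((\<lambda>t. w t * v t + u t * z t) has_integral (u b * v b - u a * v a)) {a..b}"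
proof -
  note cu = abs_cont_deriv_continuous[OF u] and cv = abs_cont_deriv_continuous[OF v]
  have ai: "w absolutely_integrable_on {a..b}" "z absolutely_integrable_on {a..b}"
    using u v by (auto simp: abs_cont_deriv_def)
  define h where "h = (\<lambda>t. w t * v t + u t * z t)"
  define k where "k = (\<lambda>t. \<bar>w t\<bar> + \<bar>z t\<bar>)"
  have "h absolutely_integrable_on {a..b}"
    unfolding h_def using cu cv ai
    by (intro set_integral_add absolutely_integrable_continuous_mult)
  then have h: "h integrable_on {a..b}"
    by (rule set_lebesgue_integral_eq_integral(1))
  have k: "k integrable_on {a..b}"
    unfolding k_def using ai
    by (intro integrable_add) (auto simp: absolutely_integrable_on_def)
  define f where "f t = u t * v t - integral {a..t} h" for t
  have "f b = f a"
  proof (rule constant_if_increments_small[where f = f and g = "\<lambda>t. integral {a..t} k"])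
    fix \<epsilon> :: real assume "\<epsilon> > 0"
    have "uniformly_continuous_on {a..b} u" "uniformly_continuous_on {a..b} v"
      using cu cv by (auto intro: compact_uniformly_continuous)
    then obtain d1 d2 where "d1 > 0" "d2 > 0"
      and d1: "\<And>x y. \<lbrakk>x \<in> {a..b}; y \<in> {a..b}; dist y x < d1\<rbrakk> \<Longrightarrow> dist (u y) (u x) < \<epsilon>"
      and d2: "\<And>x y. \<lbrakk>x \<in> {a..b}; y \<in> {a..b}; dist y x < d2\<rbrakk> \<Longrightarrow> dist (v y) (v x) < \<epsilon>"
      using \<open>\<epsilon> > 0\<close> unfolding uniformly_continuous_on_def by metis
    show "\<exists>\<delta>>0. \<forall>s t. a \<le> s \<and> s \<le> t \<and> t \<le> b \<and> t - s < \<delta> \<longrightarrow>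
        \<bar>f t - f s\<bar> \<le> \<epsilon> * (integral {a..t} k - integral {a..s} k)"
    proof (intro exI[of _ "min d1 d2"] conjI allI impI)
      show "min d1 d2 > 0"
        using \<open>d1 > 0\<close> \<open>d2 > 0\<close> by simp
      fix s t assume "a \<le> s \<and> s \<le> t \<and> t \<le> b \<and> t - s < min d1 d2"
      then have st: "a \<le> s" "s \<le> t" "t \<le> b" "t - s < min d1 d2"
        by blast+
      have hst: "h integrable_on {s..t}" and kst: "k integrable_on {s..t}"
        using st h k by (auto intro: integrable_subinterval_real)
      have comb: "integral {a..s} h + integral {s..t} h = integral {a..t} h"
        "integral {a..s} k + integral {s..t} k = integral {a..t} k"
        using st h k
        by (auto intro!: Henstock_Kurzweil_Integration.integral_combine
            intro: integrable_subinterval_real)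
      have "((\<lambda>r. w r * v t + u s * z r - h r) has_integral
          ((u t - u s) * v t + u s * (v t - v s) - integral {s..t} h)) {s..t}"
        using abs_cont_deriv_has_integral[OF u st(1-3)] abs_cont_deriv_has_integral[OF v st(1-3)] hst
        by (intro has_integral_add has_integral_diff has_integral_mult_right has_integral_mult_left
            integrable_integral)
      then have D: "((\<lambda>r. w r * v t + u s * z r - h r) has_integral (f t - f s)) {s..t}"
        by (rule has_integral_eq_rhs) (use comb(1) in \<open>simp add: f_def algebra_simps\<close>)
      have "norm (integral {s..t} (\<lambda>r. w r * v t + u s * z r - h r))
          \<le> integral {s..t} (\<lambda>r. \<epsilon> * k r)"
      proof (rule Henstock_Kurzweil_Integration.integral_norm_bound_integral)
        show "(\<lambda>r. w r * v t + u s * z r - h r) integrable_on {s..t}"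
          using D by blast
        show "(\<lambda>r. \<epsilon> * k r) integrable_on {s..t}"
          using kst by (intro integrable_on_mult_right)
        fix r assume r: "r \<in> {s..t}"
        have "\<bar>u s - u r\<bar> \<le> \<epsilon>" "\<bar>v t - v r\<bar> \<le> \<epsilon>"
          using d1[of r s] d2[of r t] r st by (auto simp: dist_real_def)
        then have "\<bar>w r\<bar> * \<bar>v t - v r\<bar> + \<bar>u s - u r\<bar> * \<bar>z r\<bar> \<le> \<bar>w r\<bar> * \<epsilon> + \<epsilon> * \<bar>z r\<bar>"
          by (intro add_mono mult_left_mono mult_right_mono) auto
        moreover have "w r * v t + u s * z r - h r = w r * (v t - v r) + (u s - u r) * z r"
          by (simp add: h_def algebra_simps)
        moreover have "\<bar>w r * (v t - v r) + (u s - u r) * z r\<bar>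
            \<le> \<bar>w r\<bar> * \<bar>v t - v r\<bar> + \<bar>u s - u r\<bar> * \<bar>z r\<bar>"
          by (metis abs_mult abs_triangle_ineq)
        ultimately show "norm (w r * v t + u s * z r - h r) \<le> \<epsilon> * k r"
          by (simp add: k_def algebra_simps)
      qed
      then show "\<bar>f t - f s\<bar> \<le> \<epsilon> * (integral {a..t} k - integral {a..s} k)"
        using D by (simp add: integral_unique flip: comb(2))
    qed
  qed fact
  then have "integral {a..b} h = u b * v b - u a * v a"
    by (simp add: f_def)
  then show ?thesis
    using h unfolding h_def by (simp add: has_integral_integrable_integral)
qed

lemma abs_cont_deriv_mult:
  assumes u: "abs_cont_deriv u w a b" and v: "abs_cont_deriv v z a b"
  shows "abs_cont_deriv (\<lambda>t. u t * v t) (\<lambda>t. w t * v t + u t * z t) a b"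
  unfolding abs_cont_deriv_def
proof (intro conjI ballI)
  show "(\<lambda>t. w t * v t + u t * z t) absolutely_integrable_on {a..b}"
    using u v abs_cont_deriv_continuous[OF u] abs_cont_deriv_continuous[OF v]
    by (intro set_integral_add absolutely_integrable_continuous_mult) (auto simp: abs_cont_deriv_def)
  fix t assume "t \<in> {a..b}"
  then show "((\<lambda>t. w t * v t + u t * z t) has_integral u t * v t - u a * v a) {a..t}"
    using abs_cont_deriv_subinterval[OF u] abs_cont_deriv_subinterval[OF v]
    by (intro abs_cont_deriv_mult_has_integral) auto
qed

section \<open>Wirtinger inequalities with sharp constants\<close>

lemma Wirtinger_subcritical:
  assumes v: "abs_cont_deriv v w a b" and w2: "(\<lambda>t. (w t)\<^sup>2) integrable_on {a..b}"
    and "a < b" "v a = 0" "v b = 0" "0 < \<kappa>" "\<kappa> * (b - a) < pi"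
  shows "\<kappa>\<^sup>2 * integral {a..b} (\<lambda>t. (v t)\<^sup>2) \<le> integral {a..b} (\<lambda>t. (w t)\<^sup>2)"
proof -
  define \<theta> where "\<theta> t = \<kappa> * (t - (a + b) / 2)" for t
  \<comment> \<open>\<open>p\<close> is y' / y for y = cos \<theta>, a solution of y'' = -
    \<kappa>^2 y without zeros on [a, b]; hence the Riccati equation p' = - \<kappa>^2 - p^2. It
    gives w^2 - \<kappa>^2 v^2 - (p v^2)' = (w - p v)^2, and the total derivative integrates to zero
    because \<open>v\<close> vanishes at both ends. Centring y at the midpoint and \<kappa> (b - a)
    < pi keep the zeros of the cosine outside the closed interval.\<close>
  define p where "p t = - (\<kappa> * tan (\<theta> t))" for t
  define p' where "p' t = - \<kappa>\<^sup>2 - (p t)\<^sup>2" for t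
  have c: "cos (\<theta> t) \<noteq> 0" if "t \<in> {a..b}" for t
  proof -
    have "\<kappa> * \<bar>t - (a + b) / 2\<bar> \<le> \<kappa> * ((b - a) / 2)"
      using that \<open>\<kappa> > 0\<close> by (intro mult_left_mono) (auto simp: abs_le_iff field_simps)
    also have "\<dots> < pi / 2"
      using \<open>\<kappa> * (b - a) < pi\<close> by simp
    finally have "\<bar>\<theta> t\<bar> < pi / 2"
      using \<open>\<kappa> > 0\<close> by (simp add: \<theta>_def abs_mult)
    then have "cos (\<theta> t) > 0"
      by (intro cos_gt_zero_pi) (auto simp: abs_less_iff)
    then show ?thesis
      by simp
  qed
  have dp: "(p has_real_derivative p' t) (at t)" if "t \<in> {a..b}" for t
  proof -
    have "(p has_real_derivative - (\<kappa> * (inverse ((cos (\<theta> t))\<^sup>2) * \<kappa>))) (at t)"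
      unfolding p_def \<theta>_def using c[OF that]
      by (auto intro!: derivative_eq_intros simp: \<theta>_def)
    moreover have "inverse ((cos (\<theta> t))\<^sup>2) = 1 + (tan (\<theta> t))\<^sup>2"
      using c[OF that] tan_sec[of "\<theta> t"] by (simp add: power_inverse)
    ultimately show ?thesis
      by (simp add: p'_def p_def power2_eq_square algebra_simps)
  qed
  have "continuous_on {a..b} p"
    using dp by (intro DERIV_continuous_on[of _ p p']) (auto intro: has_field_derivative_at_within)
  then have "continuous_on {a..b} p'"
    unfolding p'_def by (intro continuous_intros)
  with dp have "abs_cont_deriv p p' a b"
    by (rule abs_cont_deriv_smooth)
  then have 1: "((\<lambda>t. p' t * (v t * v t) + p t * (w t * v t + v t * w t)) has_integral 0) {a..b}"
    using abs_cont_deriv_mult_has_integral[of a b p p', OF _ _ abs_cont_deriv_mult[OF v v]] assms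
    by simp
  have "continuous_on {a..b} (\<lambda>t. (v t)\<^sup>2)"
    using abs_cont_deriv_continuous[OF v] by (intro continuous_intros)
  then have v2: "(\<lambda>t. (v t)\<^sup>2) integrable_on {a..b}"
    by (rule integrable_continuous_real)
  have "((\<lambda>t. (w t)\<^sup>2 - \<kappa>\<^sup>2 * (v t)\<^sup>2 - (p' t * (v t * v t) + p t * (w t * v t + v t * w t)))
      has_integral (integral {a..b} (\<lambda>t. (w t)\<^sup>2) - \<kappa>\<^sup>2 * integral {a..b} (\<lambda>t. (v t)\<^sup>2) - 0)) {a..b}"
    using 1 w2 v2 by (intro has_integral_diff has_integral_mult_right integrable_integral)
  moreover have "(w t)\<^sup>2 - \<kappa>\<^sup>2 * (v t)\<^sup>2 - (p' t * (v t * v t) + p t * (w t * v t + v t * w t))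
      = (w t - p t * v t)\<^sup>2" for t
    by (simp add: p'_def power2_eq_square algebra_simps)
  ultimately have "((\<lambda>t. (w t - p t * v t)\<^sup>2) has_integral
      (integral {a..b} (\<lambda>t. (w t)\<^sup>2) - \<kappa>\<^sup>2 * integral {a..b} (\<lambda>t. (v t)\<^sup>2))) {a..b}"
    by simp
  then have "0 \<le> integral {a..b} (\<lambda>t. (w t)\<^sup>2) - \<kappa>\<^sup>2 * integral {a..b} (\<lambda>t. (v t)\<^sup>2)"
    by (rule has_integral_nonneg) simp
  then show ?thesis
    by linarith
qed

text \<open>At the critical frequency the tangent of the preceding argument blows up at the end
  points, so this case is reached as a limit. The frequency is shrunk by \<open>sqrt z\<close>, so
  that the constant is multiplied by exactly \<open>z\<close>, and then z tends to 1.\<close>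

lemma Wirtinger_Dirichlet:
  assumes v: "abs_cont_deriv v w a b" and w2: "(\<lambda>t. (w t)\<^sup>2) integrable_on {a..b}"
    and "a < b" "v a = 0" "v b = 0"
  shows "(pi / (b - a))\<^sup>2 * integral {a..b} (\<lambda>t. (v t)\<^sup>2) \<le> integral {a..b} (\<lambda>t. (w t)\<^sup>2)"
proof (rule field_le_mult_one_interval)
  fix z :: real assume z: "0 < z" "z < 1"
  have "sqrt z * pi < 1 * pi"
    using z by (intro mult_strict_right_mono) auto
  then have "(sqrt z * (pi / (b - a)))\<^sup>2 * integral {a..b} (\<lambda>t. (v t)\<^sup>2) \<le> integral {a..b} (\<lambda>t. (w t)\<^sup>2)"
    using assms z by (intro Wirtinger_subcritical) auto
  moreover have "(sqrt z * (pi / (b - a)))\<^sup>2 = z * (pi / (b - a))\<^sup>2"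
    unfolding power_mult_distrib using z by simp
  ultimately show "z * ((pi / (b - a))\<^sup>2 * integral {a..b} (\<lambda>t. (v t)\<^sup>2)) \<le> integral {a..b} (\<lambda>t. (w t)\<^sup>2)"
    by (simp only: mult.assoc)
qed

text \<open>
  The multiple of \<open>cos (\<kappa> (t - a))\<close> with the same boundary values as \<open>u\<close> lies in the kernel of
  \<open>\<integral> w\<^sup>2 - \<kappa>\<^sup>2 u\<^sup>2\<close>, so subtracting it reduces to the Dirichlet case.
\<close>

lemma Wirtinger_antiperiodic:
  assumes u: "abs_cont_deriv u w a b" and w2: "(\<lambda>t. (w t)\<^sup>2) integrable_on {a..b}"
    and "a < b" "u b = - u a"
  shows "(pi / (b - a))\<^sup>2 * integral {a..b} (\<lambda>t. (u t)\<^sup>2) \<le> integral {a..b} (\<lambda>t. (w t)\<^sup>2)"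
proof -
  define \<kappa> where "\<kappa> = pi / (b - a)"
  define c where "c = u a"
  define S C where "S t = sin (\<kappa> * (t - a))" and "C t = cos (\<kappa> * (t - a))" for t
  define v where "v t = u t - c * C t" for t
  define z where "z t = w t + c * \<kappa> * S t" for t
  have \<kappa>: "\<kappa> * (b - a) = pi"
    using \<open>a < b\<close> by (simp add: \<kappa>_def)
  have cS [continuous_intros]: "continuous_on {a..b} S" and cC [continuous_intros]: "continuous_on {a..b} C"
    unfolding S_def C_def by (intro continuous_intros)+
  note [continuous_intros] = abs_cont_deriv_continuous[OF u]
  have w: "w absolutely_integrable_on {a..b}"
    using u by (simp add: abs_cont_deriv_def)
  have acC: "abs_cont_deriv C (\<lambda>t. - (\<kappa> * S t)) a b"
    unfolding C_def S_def
    by (rule abs_cont_deriv_smooth) (auto intro!: derivative_eq_intros continuous_intros)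
  have acS: "abs_cont_deriv S (\<lambda>t. \<kappa> * C t) a b"
    unfolding C_def S_def
    by (rule abs_cont_deriv_smooth) (auto intro!: derivative_eq_intros continuous_intros)
  have v: "abs_cont_deriv v z a b"
    unfolding abs_cont_deriv_def
  proof (intro conjI ballI)
    have "(\<lambda>t. c * \<kappa> * S t) absolutely_integrable_on {a..b}"
      by (intro absolutely_integrable_continuous_real continuous_intros)
    then show "z absolutely_integrable_on {a..b}"
      unfolding z_def using w by (intro set_integral_add)
    fix t assume t: "t \<in> {a..b}"
    have "((\<lambda>t. w t - c * - (\<kappa> * S t)) has_integral (u t - u a - c * (C t - C a))) {a..t}"
      using u acC t by (intro has_integral_diff has_integral_mult_right) (auto simp: abs_cont_deriv_def)
    then show "(z has_integral v t - v a) {a..t}"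
      by (simp add: z_def[abs_def] v_def algebra_simps)
  qed
  have wS: "(\<lambda>t. w t * S t) integrable_on {a..b}"
    using w by (intro set_lebesgue_integral_eq_integral(1) absolutely_integrable_continuous_mult
        continuous_intros)
  have "(\<lambda>t. (w t)\<^sup>2 + 2 * c * \<kappa> * (w t * S t) + c\<^sup>2 * \<kappa>\<^sup>2 * (S t)\<^sup>2) integrable_on {a..b}"
    by (intro integrable_add integrable_on_mult_right[where f = "\<lambda>t. (S t)\<^sup>2"]
        integrable_on_mult_right[OF wS] w2)
      (rule integrable_continuous_real, rule continuous_on_power, fact)
  moreover have "(w t)\<^sup>2 + 2 * c * \<kappa> * (w t * S t) + c\<^sup>2 * \<kappa>\<^sup>2 * (S t)\<^sup>2 = (z t)\<^sup>2" for t
    by (simp add: z_def power2_eq_square algebra_simps)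
  ultimately have z2: "(\<lambda>t. (z t)\<^sup>2) integrable_on {a..b}"
    by simp
  have "v a = 0" "v b = 0"
    using \<kappa> \<open>u b = - u a\<close> by (auto simp: v_def c_def C_def)
  with v z2 \<open>a < b\<close>
  have main: "\<kappa>\<^sup>2 * integral {a..b} (\<lambda>t. (v t)\<^sup>2) \<le> integral {a..b} (\<lambda>t. (z t)\<^sup>2)"
    unfolding \<kappa>_def by (intro Wirtinger_Dirichlet)
  have v2: "(\<lambda>t. (v t)\<^sup>2) integrable_on {a..b}"
    unfolding v_def by (intro integrable_continuous_real continuous_intros)
  have u2: "(\<lambda>t. (u t)\<^sup>2) integrable_on {a..b}"
    by (intro integrable_continuous_real continuous_intros)
  \<comment> \<open>Expanding the form at \<open>u - c * C\<close> leaves a cross term and a pure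
    cosine term. They are multiples of the derivatives of \<open>u * S\<close> and
    \<open>S * C\<close>, whose integrals vanish because \<open>S\<close> is zero at both
    ends.\<close>
  have "S a = 0" "S b = 0"
    using \<kappa> by (auto simp: S_def)
  then have i1: "((\<lambda>t. w t * S t + u t * (\<kappa> * C t)) has_integral 0) {a..b}"
    and i2: "((\<lambda>t. \<kappa> * C t * C t + S t * - (\<kappa> * S t)) has_integral 0) {a..b}"
    using abs_cont_deriv_mult_has_integral[OF _ u acS] abs_cont_deriv_mult_has_integral[OF _ acS acC]
      \<open>a < b\<close> by auto
  have "((\<lambda>t. ((w t)\<^sup>2 - \<kappa>\<^sup>2 * (u t)\<^sup>2) + 2 * c * \<kappa> * (w t * S t + u t * (\<kappa> * C t))
        - c\<^sup>2 * \<kappa> * (\<kappa> * C t * C t + S t * - (\<kappa> * S t)))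
      has_integral ((integral {a..b} (\<lambda>t. (w t)\<^sup>2) - \<kappa>\<^sup>2 * integral {a..b} (\<lambda>t. (u t)\<^sup>2))
        + 2 * c * \<kappa> * 0 - c\<^sup>2 * \<kappa> * 0)) {a..b}"
    using w2 u2 by (intro has_integral_add has_integral_diff has_integral_mult_right integrable_integral i1 i2)
  moreover have "((w t)\<^sup>2 - \<kappa>\<^sup>2 * (u t)\<^sup>2) + 2 * c * \<kappa> * (w t * S t + u t * (\<kappa> * C t))
        - c\<^sup>2 * \<kappa> * (\<kappa> * C t * C t + S t * - (\<kappa> * S t)) = (z t)\<^sup>2 - \<kappa>\<^sup>2 * (v t)\<^sup>2" for t
    by (simp add: z_def v_def power2_eq_square algebra_simps)
  moreover have "((\<lambda>t. (z t)\<^sup>2 - \<kappa>\<^sup>2 * (v t)\<^sup>2) has_integral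
      (integral {a..b} (\<lambda>t. (z t)\<^sup>2) - \<kappa>\<^sup>2 * integral {a..b} (\<lambda>t. (v t)\<^sup>2))) {a..b}"
    using z2 v2 by (intro has_integral_diff has_integral_mult_right integrable_integral)
  ultimately have "integral {a..b} (\<lambda>t. (w t)\<^sup>2) - \<kappa>\<^sup>2 * integral {a..b} (\<lambda>t. (u t)\<^sup>2)
      = integral {a..b} (\<lambda>t. (z t)\<^sup>2) - \<kappa>\<^sup>2 * integral {a..b} (\<lambda>t. (v t)\<^sup>2)"
    by (simp add: has_integral_unique)
  with main have "\<kappa>\<^sup>2 * integral {a..b} (\<lambda>t. (u t)\<^sup>2) \<le> integral {a..b} (\<lambda>t. (w t)\<^sup>2)"
    by linarith
  then show ?thesis
    unfolding \<kappa>_def .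
qed

text \<open>All pieces have length \<tau> / n and hence the same constant, so the inequalities add
  up. Alternation is weaker than vanishing at the nodes but costs nothing: on one piece the
  half-wave cosine has the same frequency as the half-wave sine.\<close>

lemma Wirtinger_sign_alternating:
  fixes n :: nat
  assumes u: "abs_cont_deriv u w 0 \<tau>" and w2: "(\<lambda>t. (w t)\<^sup>2) integrable_on {0..\<tau>}"
    and "0 < \<tau>" "n > 0"
    and alt: "\<And>j. j < n \<Longrightarrow> u (real (Suc j) * \<tau> / real n) = - u (real j * \<tau> / real n)"
  shows "(real n * pi / \<tau>)\<^sup>2 * integral {0..\<tau>} (\<lambda>t. (u t)\<^sup>2) \<le> integral {0..\<tau>} (\<lambda>t. (w t)\<^sup>2)"
proof -
  define x where "x j = real j * \<tau> / real n" for j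
  have xmono: "x i \<le> x j" if "i \<le> j" for i j
    unfolding x_def using that \<open>0 < \<tau>\<close> by (intro divide_right_mono mult_right_mono) auto
  have x0: "x 0 = 0" and xn: "x n = \<tau>"
    using \<open>n > 0\<close> by (auto simp: x_def)
  have u2: "(\<lambda>t. (u t)\<^sup>2) integrable_on {0..\<tau>}"
    using abs_cont_deriv_continuous[OF u] by (intro integrable_continuous_real continuous_intros)
  define K where "K = (real n * pi / \<tau>)\<^sup>2"
  have "K * integral {0..x j} (\<lambda>t. (u t)\<^sup>2) \<le> integral {0..x j} (\<lambda>t. (w t)\<^sup>2)"
    if "j \<le> n" for j
    using that
  proof (induction j)
    case 0
    then show ?case by (simp add: x0)
  next
    case (Suc j)
    have le: "0 \<le> x j" "x j \<le> x (Suc j)" "x (Suc j) \<le> \<tau>"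
      using xmono[of 0 j] xmono[of j "Suc j"] xmono[of "Suc j" n] Suc.prems by (auto simp: x0 xn)
    have gap: "x (Suc j) - x j = \<tau> / real n"
      by (simp add: x_def distrib_right add_divide_distrib)
    then have "x j < x (Suc j)"
      using \<open>0 < \<tau>\<close> \<open>n > 0\<close> by (smt (verit) divide_pos_pos of_nat_0_less_iff)
    then have "(pi / (x (Suc j) - x j))\<^sup>2 * integral {x j..x (Suc j)} (\<lambda>t. (u t)\<^sup>2)
        \<le> integral {x j..x (Suc j)} (\<lambda>t. (w t)\<^sup>2)"
      using le alt[of j] Suc.prems w2
      by (intro Wirtinger_antiperiodic abs_cont_deriv_subinterval[OF u])
        (auto simp: x_def intro: integrable_subinterval_real)
    moreover have "pi / (x (Suc j) - x j) = real n * pi / \<tau>"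
      using gap by simp
    ultimately have "K * integral {x j..x (Suc j)} (\<lambda>t. (u t)\<^sup>2)
        \<le> integral {x j..x (Suc j)} (\<lambda>t. (w t)\<^sup>2)"
      unfolding K_def by metis
    moreover have comb: "integral {0..x (Suc j)} f = integral {0..x j} f + integral {x j..x (Suc j)} f"
      if "f integrable_on {0..\<tau>}" for f :: "real \<Rightarrow> real"
      using le by (intro Henstock_Kurzweil_Integration.integral_combine[symmetric]
          integrable_subinterval_real[OF that]) auto
    ultimately show ?case
      using Suc by (simp add: comb[OF u2] comb[OF w2] distrib_left)
  qed
  from this[of n] show ?thesis
    unfolding xn K_def by simp
qed

section \<open>Bounds for the Morse index\<close>

lemma sum_fun_apply: "(\<Sum>i\<in>I. f i) x = (\<Sum>i\<in>I. f i x)"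
  for f :: "'i \<Rightarrow> 'a \<Rightarrow> 'b::comm_monoid_add"
  by (induction I rule: infinite_finite_induct) auto

text \<open>Rank and nullity. The functionals are bundled into one map \<open>F\<close> to sequences
  supported below \<open>N\<close>, which stand in for a coordinate space whose dimension is a
  variable. If \<open>F\<close> were injective on \<open>W\<close>, a basis of \<open>W\<close>
  would yield more than \<open>N\<close> independent vectors in the span of \<open>N\<close> unit
  sequences.\<close>

lemma exists_nonzero_in_kernel:
  fixes W :: "'v::real_vector set" and \<phi> :: "nat \<Rightarrow> 'v \<Rightarrow> real"
  assumes W: "subspace W" and "finite B" "span B = W"
    and lin: "\<And>i. i < N \<Longrightarrow> linear (\<phi> i)" and "N < dim W"
  shows "\<exists>v\<in>W. v \<noteq> 0 \<and> (\<forall>i<N. \<phi> i v = 0)"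
proof (rule ccontr)
  assume *: "\<not> ?thesis"
  define F where "F v = (\<lambda>i. if i < N then \<phi> i v else 0)" for v
  have F: "linear F"
    using lin by (intro linearI) (auto simp: F_def fun_eq_iff scaleR_fun_def linear_add linear_scale)
  define E where "E i = (\<lambda>j. if j = i then 1 else 0 :: real)" for i :: nat
  have range: "F v \<in> span (E ` {..<N})" for v
  proof -
    have "F v = (\<Sum>i<N. \<phi> i v *\<^sub>R E i)"
      by (auto simp: F_def E_def fun_eq_iff sum_fun_apply scaleR_fun_def if_distrib cong: if_cong)
    also have "\<dots> \<in> span (E ` {..<N})"
      by (intro span_sum span_scale span_base) auto
    finally show ?thesis .
  qed
  obtain C where C: "C \<subseteq> W" "independent C" "W \<subseteq> span C" "card C = dim W"
    by (rule basis_exists)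
  have "span C = W"
    using C W by (simp add: span_minimal subset_antisym)
  have "inj_on F (span C)"
    unfolding \<open>span C = W\<close>
  proof (rule inj_onI)
    fix x y assume "x \<in> W" "y \<in> W" "F x = F y"
    then have "F (x - y) = 0" "x - y \<in> W"
      using F W by (auto simp: linear_diff subspace_diff)
    moreover have "\<phi> i (x - y) = 0" if "i < N" for i
      using \<open>F (x - y) = 0\<close> that by (auto simp: F_def fun_eq_iff split: if_splits)
    ultimately show "x = y"
      using * by auto
  qed
  then have "independent (F ` C)" "inj_on F C"
    using linear_independent_injective_image[OF F] C(2)
    using span_superset[of C] by (auto intro: inj_on_subset)
  then have "card C \<le> card (E ` {..<N})"
    using independent_span_bound[of "E ` {..<N}" "F ` C"] range by (auto simp: card_image)
  also have "\<dots> \<le> N"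
    using card_image_le[of "{..<N}" E] by simp
  finally show False
    using C(4) \<open>N < dim W\<close> by simp
qed

text \<open>A subspace of dimension above \<open>N\<close> meets the common kernel of
  \<open>N\<close> functionals in a nonzero vector, where \<open>Q\<close> would have to be both
  negative and nonnegative.\<close>

lemma morse_index_le:
  fixes \<phi> :: "nat \<Rightarrow> 'v::real_vector \<Rightarrow> real"
  assumes "\<And>i. i < N \<Longrightarrow> linear (\<phi> i)"
    and "\<And>v. \<lbrakk>v \<in> V; \<And>i. i < N \<Longrightarrow> \<phi> i v = 0\<rbrakk> \<Longrightarrow> 0 \<le> Q v"
  shows "morse_index V Q \<le> enat N"
  unfolding morse_index_def
proof (rule Sup_least, clarsimp)
  fix B :: "'v set"
  assume B: "finite B" "span B \<subseteq> V" "\<forall>v\<in>span B. v \<noteq> 0 \<longrightarrow> Q v < 0"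
  show "dim B \<le> N"
  proof (rule ccontr)
    assume "\<not> ?thesis"
    then have "\<exists>v\<in>span B. v \<noteq> 0 \<and> (\<forall>i<N. \<phi> i v = 0)"
      using B(1) assms(1) by (intro exists_nonzero_in_kernel[of _ B]) auto
    then show False
      using B(2,3) assms(2) by (meson in_mono not_less)
  qed
qed

text \<open>Negativity on all nontrivial combinations already contains the independence of the
  family: a vanishing combination with a nonzero coefficient would give \<open>Q 0 < 0\<close>. The
  modes thus never have to be shown distinct or independent separately.\<close>

lemma morse_index_ge:
  fixes e :: "'i \<Rightarrow> 'v::real_vector"
  assumes "finite I" and "0 \<le> Q 0"
    and V: "\<And>c. (\<Sum>i\<in>I. c i *\<^sub>R e i) \<in> V"
    and neg: "\<And>c j. \<lbrakk>j \<in> I; c j \<noteq> 0\<rbrakk> \<Longrightarrow> Q (\<Sum>i\<in>I. c i *\<^sub>R e i) < 0"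
  shows "enat (card I) \<le> morse_index V Q"
proof -
  have inj: "inj_on e I"
  proof (rule inj_onI, rule ccontr)
    fix i j assume ij: "i \<in> I" "j \<in> I" "e i = e j" "i \<noteq> j"
    define c where "c k = (if k = i then 1 else if k = j then -1 else 0 :: real)" for k
    have "(\<Sum>k\<in>I. c k *\<^sub>R e k) = (\<Sum>k\<in>{i, j}. c k *\<^sub>R e k)"
      using ij \<open>finite I\<close> by (intro sum.mono_neutral_right) (auto simp: c_def)
    also have "\<dots> = 0"
      using ij by (simp add: c_def)
    finally show False
      using neg[of i c] ij \<open>0 \<le> Q 0\<close> by (simp add: c_def)
  qed
  have span: "\<exists>c. v = (\<Sum>i\<in>I. c i *\<^sub>R e i)" if v: "v \<in> span (e ` I)" for v
  proof -
    obtain r where "v = (\<Sum>x\<in>e ` I. r x *\<^sub>R x)"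
      using v \<open>finite I\<close> by (auto simp: span_finite)
    then show ?thesis
      using inj by (auto simp: sum.reindex o_def intro!: exI[of _ "\<lambda>i. r (e i)"])
  qed
  have "independent (e ` I)"
  proof (rule independent_if_scalars_zero)
    fix r x assume 0: "(\<Sum>x\<in>e ` I. r x *\<^sub>R x) = 0" and x: "x \<in> e ` I"
    then obtain j where "j \<in> I" "x = e j"
      by blast
    moreover have "(\<Sum>i\<in>I. r (e i) *\<^sub>R e i) = 0"
      using 0 inj by (simp add: sum.reindex)
    ultimately show "r x = 0"
      using neg[of j "\<lambda>i. r (e i)"] \<open>0 \<le> Q 0\<close> by fastforce
  qed (use \<open>finite I\<close> in simp)
  then have "dim (span (e ` I)) = card I"
    using inj by (simp add: dim_eq_card_independent card_image)
  moreover have "span (e ` I) \<subseteq> V"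
    using span V by blast
  moreover have "Q v < 0" if v: "v \<in> span (e ` I)" "v \<noteq> 0" for v
  proof -
    obtain c where c: "v = (\<Sum>i\<in>I. c i *\<^sub>R e i)"
      using span[OF v(1)] by auto
    have "v = 0" if "\<forall>j\<in>I. c j = 0"
      unfolding c using that by (intro sum.neutral) simp
    then obtain j where "j \<in> I" "c j \<noteq> 0"
      using v(2) by blast
    then show ?thesis
      using neg[of j c] c by simp
  qed
  ultimately have "enat (card I) \<in> {enat (dim W) | W. subspace W \<and> (\<exists>B. finite B \<and> span B = W) \<and>
      W \<subseteq> V \<and> (\<forall>v\<in>W. v \<noteq> 0 \<longrightarrow> Q v < 0)}"
    using \<open>finite I\<close> subspace_span[of "e ` I"] finite_imageI[of I e] by (smt (verit) mem_Collect_eq)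
  then show ?thesis
    unfolding morse_index_def by (rule Sup_upper)
qed

section \<open>Weak derivatives\<close>

lemma has_H1_deriv_abs_cont:
  "has_H1_deriv u w a b \<longleftrightarrow> abs_cont_deriv u w a b \<and> (\<lambda>t. (w t)\<^sup>2) integrable_on {a..b}"
  for u w :: "real \<Rightarrow> real"
  by (auto simp: has_H1_deriv_def abs_cont_deriv_def)

text \<open>The difference of two weak derivatives has integral zero over every subinterval.
  Extended by zero, it has integral zero over every interval of the line, so all its averages over
  [x, x + h] vanish. By Lebesgue differentiation these averages converge to its value outside a null
  set.\<close>

lemma has_H1_deriv_unique_ae:
  fixes u :: "real \<Rightarrow> 'a::euclidean_space"
  assumes "has_H1_deriv u w a b" "has_H1_deriv u z a b"
  obtains N where "negligible N" "\<And>t. t \<in> {a..b} - N \<Longrightarrow> w t = z t"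
proof -
  define f where "f t = (if t \<in> {a..b} then w t - z t else 0)" for t
  have zero: "((\<lambda>t. w t - z t) has_integral 0) {a..t}" if "t \<in> {a..b}" for t
    using assms that has_integral_diff[of w "u t - u a" "{a..t}" z "u t - u a"]
    by (auto simp: has_H1_deriv_def)
  have sub: "((\<lambda>t. w t - z t) has_integral 0) {s..t}" if "a \<le> s" "s \<le> t" "t \<le> b" for s t
  proof -
    have "integral {a..s} (\<lambda>t. w t - z t) + integral {s..t} (\<lambda>t. w t - z t)
        = integral {a..t} (\<lambda>t. w t - z t)"
      using zero[of t] that by (intro Henstock_Kurzweil_Integration.integral_combine) auto
    then have "integral {s..t} (\<lambda>t. w t - z t) = 0"
      using zero[of t] zero[of s] that by (simp add: integral_unique)
    moreover have "(\<lambda>t. w t - z t) integrable_on {s..t}"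
      using zero[of t] that by (auto intro: integrable_subinterval_real)
    ultimately show ?thesis
      by (simp add: has_integral_integrable_integral)
  qed
  have f0: "(f has_integral 0) {c..d}" for c d
  proof -
    have "((\<lambda>t. w t - z t) has_integral 0) ({a..b} \<inter> {c..d})"
      using sub[of "max a c" "min b d"] by (cases "max a c \<le> min b d") auto
    then show ?thesis
      unfolding f_def has_integral_restrict_Int by simp
  qed
  then obtain N where N: "negligible N" and N': "\<And>x e. \<lbrakk>x \<notin> N; 0 < e\<rbrakk> \<Longrightarrow>
      \<exists>d>0. \<forall>h. 0 < h \<and> h < d \<longrightarrow> norm (integral (cbox x (x + h *\<^sub>R One)) f /\<^sub>R h ^ DIM(real) - f x) < e"
    using integrable_ccontinuous_explicit[of f] by (metis box_real(2) has_integral_integrable)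
  have "f x = 0" if x: "x \<notin> N" for x
  proof (rule ccontr)
    assume "f x \<noteq> 0"
    then obtain d where "d > 0" and
      *: "\<And>h. \<lbrakk>0 < h; h < d\<rbrakk> \<Longrightarrow> norm (integral (cbox x (x + h *\<^sub>R One)) f /\<^sub>R h ^ DIM(real) - f x) < norm (f x)"
      using N'[OF x, of "norm (f x)"] by auto
    show False
      using *[of "d / 2"] \<open>d > 0\<close> by (simp add: integral_unique[OF f0])
  qed
  then have "w t = z t" if "t \<in> {a..b} - N" for t
    using that unfolding f_def by (metis DiffD1 DiffD2 eq_iff_diff_eq_0)
  with N that show ?thesis
    by blast
qed

text \<open>This removes the choice operator from the functionals: any known weak derivative may
  replace the chosen one. \<open>f\<close> is arbitrary because the two integrands agree off a null
  set, whether or not they are integrable.\<close>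

lemma integral_weak_deriv:
  fixes u :: "real \<Rightarrow> 'a::euclidean_space"
  assumes "has_H1_deriv u w a b"
  shows "integral {a..b} (\<lambda>t. f t (weak_deriv a b u t)) = integral {a..b} (\<lambda>t. f t (w t))"
proof -
  have "has_H1_deriv u (weak_deriv a b u) a b"
    unfolding weak_deriv_def using assms by (rule someI[where P = "\<lambda>w. has_H1_deriv u w a b"])
  from has_H1_deriv_unique_ae[OF this assms] obtain N
    where "negligible N" "\<And>t. t \<in> {a..b} - N \<Longrightarrow> weak_deriv a b u t = w t"
    by blast
  then show ?thesis
    by (intro integral_spike[of N]) auto
qed

lemma has_H1_deriv_components:
  fixes u w :: "real \<Rightarrow> real \<times> real"
  shows "has_H1_deriv u w a b \<longleftrightarrow>
    has_H1_deriv (\<lambda>t. fst (u t)) (\<lambda>t. fst (w t)) a b \<and> has_H1_deriv (\<lambda>t. snd (u t)) (\<lambda>t. snd (w t)) a b"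
    (is "?L \<longleftrightarrow> ?X \<and> ?Y")
proof
  have n2: "(norm (w t))\<^sup>2 = (fst (w t))\<^sup>2 + (snd (w t))\<^sup>2" for t
    by (simp add: norm_prod_def)
  {
    assume L: ?L
    then have w: "w absolutely_integrable_on {a..b}" and w2: "(\<lambda>t. (norm (w t))\<^sup>2) integrable_on {a..b}"
      by (auto simp: has_H1_deriv_def)
    have ai: "(\<lambda>t. fst (w t)) absolutely_integrable_on {a..b}"
      "(\<lambda>t. snd (w t)) absolutely_integrable_on {a..b}"
      using absolutely_integrable_linear[OF w bounded_linear_fst]
        absolutely_integrable_linear[OF w bounded_linear_snd] by (auto simp: o_def)
    then have "(\<lambda>t. fst (w t)) \<in> borel_measurable (lebesgue_on {a..b})"
      "(\<lambda>t. snd (w t)) \<in> borel_measurable (lebesgue_on {a..b})"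
      by (auto intro: absolutely_integrable_imp_borel_measurable)
    then have m: "(\<lambda>t. (fst (w t))\<^sup>2) \<in> borel_measurable (lebesgue_on {a..b})"
      "(\<lambda>t. (snd (w t))\<^sup>2) \<in> borel_measurable (lebesgue_on {a..b})"
      by (auto intro: borel_measurable_power)
    \<comment> \<open>Each squared component is measurable and dominated by the squared
      norm.\<close>
    have "(\<lambda>t. (fst (w t))\<^sup>2) integrable_on {a..b}" "(\<lambda>t. (snd (w t))\<^sup>2) integrable_on {a..b}"
      by (rule measurable_bounded_by_integrable_imp_integrable[OF m(1) w2], simp add: n2, simp)
        (rule measurable_bounded_by_integrable_imp_integrable[OF m(2) w2], simp add: n2, simp)
    moreover have "((\<lambda>t. fst (w t)) has_integral (fst (u t) - fst (u a))) {a..t}"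
      "((\<lambda>t. snd (w t)) has_integral (snd (u t) - snd (u a))) {a..t}" if "t \<in> {a..b}" for t
    proof -
      have i: "(w has_integral (u t - u a)) {a..t}"
        using L that by (auto simp: has_H1_deriv_def)
      show "((\<lambda>t. fst (w t)) has_integral (fst (u t) - fst (u a))) {a..t}"
        "((\<lambda>t. snd (w t)) has_integral (snd (u t) - snd (u a))) {a..t}"
        using has_integral_linear[OF i bounded_linear_fst] has_integral_linear[OF i bounded_linear_snd]
        by (auto simp: o_def)
    qed
    ultimately show "?X \<and> ?Y"
      using ai by (auto simp: has_H1_deriv_def)
  }
  {
    assume R: "?X \<and> ?Y"
    have bl: "bounded_linear (\<lambda>x::real. (x, 0::real))" "bounded_linear (\<lambda>x::real. (0::real, x))"
      by (auto intro!: bounded_linear_intros bounded_linear_Pair)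
    have eq: "(\<lambda>t. (fst (w t), 0) + (0, snd (w t))) = w"
      by auto
    have "(\<lambda>t. (fst (w t), 0) + (0, snd (w t))) absolutely_integrable_on {a..b}"
      using R absolutely_integrable_linear[OF _ bl(1), where f = "\<lambda>t. fst (w t)"]
        absolutely_integrable_linear[OF _ bl(2), where f = "\<lambda>t. snd (w t)"]
      by (intro set_integral_add) (auto simp: has_H1_deriv_def o_def)
    then have "w absolutely_integrable_on {a..b}"
      by (simp add: eq)
    moreover have "(\<lambda>t. (norm (w t))\<^sup>2) integrable_on {a..b}"
      unfolding n2 using R by (intro integrable_add) (auto simp: has_H1_deriv_def)
    moreover have "(w has_integral (u t - u a)) {a..t}" if "t \<in> {a..b}" for t
    proof -
      have "((\<lambda>t. (fst (w t), 0) + (0, snd (w t))) has_integral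
          (fst (u t) - fst (u a), 0) + (0, snd (u t) - snd (u a))) {a..t}"
        using R that has_integral_linear[OF _ bl(1), where f = "\<lambda>t. fst (w t)"]
          has_integral_linear[OF _ bl(2), where f = "\<lambda>t. snd (w t)"]
        by (intro has_integral_add) (auto simp: has_H1_deriv_def o_def)
      then show ?thesis
        unfolding eq by (rule has_integral_eq_rhs) (simp add: prod_eq_iff)
    qed
    ultimately show ?L
      by (simp add: has_H1_deriv_def)
  }
qed

lemma has_H1_deriv_add_scaleR:
  fixes u v :: "real \<Rightarrow> real"
  assumes "has_H1_deriv u w a b" "has_H1_deriv v z a b"
  shows "has_H1_deriv (\<lambda>t. u t + c * v t) (\<lambda>t. w t + c * z t) a b"
proof -
  have m: "w \<in> borel_measurable (lebesgue_on {a..b})" "z \<in> borel_measurable (lebesgue_on {a..b})"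
    and w2: "(\<lambda>t. (w t)\<^sup>2) integrable_on {a..b}" and z2: "(\<lambda>t. (z t)\<^sup>2) integrable_on {a..b}"
    using assms by (auto simp: has_H1_deriv_def intro: absolutely_integrable_imp_borel_measurable)
  \<comment> \<open>The mixed term of the square is the only one not integrable by hypothesis; it is
    dominated by w^2 + z^2.\<close>
  have "(\<lambda>t. w t * z t) integrable_on {a..b}"
  proof (rule measurable_bounded_by_integrable_imp_integrable)
    show "(\<lambda>t. (w t)\<^sup>2 + (z t)\<^sup>2) integrable_on {a..b}"
      using w2 z2 by (rule integrable_add)
    fix t
    have "2 * \<bar>w t\<bar> * \<bar>z t\<bar> \<le> \<bar>w t\<bar>\<^sup>2 + \<bar>z t\<bar>\<^sup>2"
      by (rule sum_squares_bound)
    moreover have "0 \<le> \<bar>w t\<bar> * \<bar>z t\<bar>"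
      by simp
    ultimately show "norm (w t * z t) \<le> (w t)\<^sup>2 + (z t)\<^sup>2"
      unfolding real_norm_def abs_mult power2_abs by linarith
  qed (use m in auto)
  then have "(\<lambda>t. (w t)\<^sup>2 + 2 * c * (w t * z t) + c\<^sup>2 * (z t)\<^sup>2) integrable_on {a..b}"
    using w2 z2 by (intro integrable_add integrable_on_mult_right)
  moreover have "(w t)\<^sup>2 + 2 * c * (w t * z t) + c\<^sup>2 * (z t)\<^sup>2 = (w t + c * z t)\<^sup>2" for t
    by (simp add: power2_eq_square algebra_simps)
  ultimately have "(\<lambda>t. (norm (w t + c * z t))\<^sup>2) integrable_on {a..b}"
    by simp
  moreover have "(\<lambda>t. w t + c * z t) absolutely_integrable_on {a..b}"
    using assms by (intro set_integral_add set_integrable_mult_right) (auto simp: has_H1_deriv_def)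
  moreover have "((\<lambda>t. w t + c * z t) has_integral (u t + c * v t - (u a + c * v a))) {a..t}"
    if "t \<in> {a..b}" for t
  proof -
    have "((\<lambda>t. w t + c * z t) has_integral (u t - u a + c * (v t - v a))) {a..t}"
      using assms that by (intro has_integral_add has_integral_mult_right) (auto simp: has_H1_deriv_def)
    then show ?thesis
      by (simp add: algebra_simps)
  qed
  ultimately show ?thesis
    by (auto simp: has_H1_deriv_def)
qed

lemma has_H1_deriv_smooth:
  fixes g g' :: "real \<Rightarrow> real"
  assumes "\<And>t. (g has_real_derivative g' t) (at t)" "continuous_on UNIV g'"
  shows "has_H1_deriv g g' a b"
proof -
  have "continuous_on {a..b} g'"
    using assms(2) by (rule continuous_on_subset) simp
  then show ?thesis
    unfolding has_H1_deriv_abs_cont using assms(1)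
    by (intro conjI abs_cont_deriv_smooth integrable_continuous_real continuous_intros)
qed

section \<open>Second variations\<close>

text \<open>
  With \<open>T\<close> the period of the orbit, \<open>(A, B, \<tau>)\<close> is \<open>(1, \<mu>, T)\<close> in the fixed-time and
  Dirichlet problems and \<open>(T, T \<mu>, 1)\<close> in the free-period problem; in both cases
  \<open>A \<tau> = 2 \<pi> / \<mu>\<close> and \<open>B \<tau> = 2 \<pi>\<close>. The function \<open>z\<close> plays the role of a weak derivative of \<open>v\<close>.
\<close>

definition oscillator_form :: "real \<Rightarrow> real \<Rightarrow> real \<Rightarrow> (real \<Rightarrow> real \<times> real) \<Rightarrow> (real \<Rightarrow> real \<times> real) \<Rightarrow> real"
  where "oscillator_form A B \<tau> v z =
    (integral {0..\<tau>} (\<lambda>t. (fst (z t))\<^sup>2) - A\<^sup>2 * integral {0..\<tau>} (\<lambda>t. (fst (v t))\<^sup>2)) +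
    (integral {0..\<tau>} (\<lambda>t. (snd (z t))\<^sup>2) - B\<^sup>2 * integral {0..\<tau>} (\<lambda>t. (snd (v t))\<^sup>2))"

text \<open>The Lagrangian is quadratic, so along a line of curves its integral is a polynomial in
  \<epsilon>: the P's come from kinetic energy, the R's from the potential. The parameter
  \<open>c\<close> is the period by which velocities are divided. It is 1 in the fixed-time case and
  \<open>T + \<epsilon> * b\<close> in the free-period case, so one computation serves both.\<close>

lemma Lagrangian_integral_expansion:
  fixes \<mu> :: real
  assumes g: "has_H1_deriv g g' 0 \<tau>" and v: "has_H1_deriv v z 0 \<tau>" and "0 \<le> \<tau>"
    and cont: "continuous_on {0..\<tau>} g'"
  defines "P0 \<equiv> integral {0..\<tau>} (\<lambda>t. (g' t)\<^sup>2) / 2"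
    and "P1 \<equiv> integral {0..\<tau>} (\<lambda>t. g' t * snd (z t))"
    and "P2 \<equiv> (integral {0..\<tau>} (\<lambda>t. (fst (z t))\<^sup>2) + integral {0..\<tau>} (\<lambda>t. (snd (z t))\<^sup>2)) / 2"
    and "R0 \<equiv> \<mu>\<^sup>2 * integral {0..\<tau>} (\<lambda>t. (g t)\<^sup>2) / 2"
    and "R1 \<equiv> \<mu>\<^sup>2 * integral {0..\<tau>} (\<lambda>t. g t * snd (v t))"
    and "R2 \<equiv> (integral {0..\<tau>} (\<lambda>t. (fst (v t))\<^sup>2) + \<mu>\<^sup>2 * integral {0..\<tau>} (\<lambda>t. (snd (v t))\<^sup>2)) / 2"
  shows "integral {0..\<tau>} (\<lambda>t. oscillator_lagrangian \<mu> (((\<lambda>t. (0, g t)) + \<epsilon> *\<^sub>R v) t)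
        (weak_deriv 0 \<tau> ((\<lambda>t. (0, g t)) + \<epsilon> *\<^sub>R v) t /\<^sub>R c) + k)
    = (P0 + \<epsilon> * P1 + \<epsilon>\<^sup>2 * P2) / c\<^sup>2 - (R0 + \<epsilon> * R1 + \<epsilon>\<^sup>2 * R2) + \<tau> * k"
proof -
  have vx: "has_H1_deriv (\<lambda>t. fst (v t)) (\<lambda>t. fst (z t)) 0 \<tau>"
    and vy: "has_H1_deriv (\<lambda>t. snd (v t)) (\<lambda>t. snd (z t)) 0 \<tau>"
    using v by (auto simp: has_H1_deriv_components[of v])
  let ?q = "(\<lambda>t. (0, g t)) + \<epsilon> *\<^sub>R v"
  let ?p = "\<lambda>t. (\<epsilon> * fst (z t), g' t + \<epsilon> * snd (z t))"
  have "has_H1_deriv (\<lambda>_::real. 0::real) (\<lambda>_. 0) 0 \<tau>"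
    by (rule has_H1_deriv_smooth) auto
  from has_H1_deriv_add_scaleR[OF this vx, of \<epsilon>] has_H1_deriv_add_scaleR[OF g vy, of \<epsilon>]
  have "has_H1_deriv ?q ?p 0 \<tau>"
    by (intro has_H1_deriv_components[THEN iffD2] conjI) (simp_all add: scaleR_fun_def)
  then have "integral {0..\<tau>} (\<lambda>t. oscillator_lagrangian \<mu> (?q t) (weak_deriv 0 \<tau> ?q t /\<^sub>R c) + k)
      = integral {0..\<tau>} (\<lambda>t. oscillator_lagrangian \<mu> (?q t) (?p t /\<^sub>R c) + k)"
    by (rule integral_weak_deriv)
  also have "\<dots> = (P0 + \<epsilon> * P1 + \<epsilon>\<^sup>2 * P2) / c\<^sup>2 - (R0 + \<epsilon> * R1 + \<epsilon>\<^sup>2 * R2) + \<tau> * k"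
  proof (rule integral_unique)
    have zx: "(\<lambda>t. (fst (z t))\<^sup>2) integrable_on {0..\<tau>}" and zy: "(\<lambda>t. (snd (z t))\<^sup>2) integrable_on {0..\<tau>}"
      using vx vy by (auto simp: has_H1_deriv_def)
    have cg: "continuous_on {0..\<tau>} g" and cx: "continuous_on {0..\<tau>} (\<lambda>t. fst (v t))"
      and cy: "continuous_on {0..\<tau>} (\<lambda>t. snd (v t))"
      using g vx vy by (auto simp: has_H1_deriv_abs_cont intro: abs_cont_deriv_continuous)
    have gz: "(\<lambda>t. g' t * snd (z t)) integrable_on {0..\<tau>}"
      using vy by (intro set_lebesgue_integral_eq_integral(1) absolutely_integrable_continuous_mult cont)
        (auto simp: has_H1_deriv_def)
    have gg: "(\<lambda>t. (g' t)\<^sup>2) integrable_on {0..\<tau>}" "(\<lambda>t. (g t)\<^sup>2) integrable_on {0..\<tau>}"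
      "(\<lambda>t. g t * snd (v t)) integrable_on {0..\<tau>}"
      "(\<lambda>t. (fst (v t))\<^sup>2) integrable_on {0..\<tau>}" "(\<lambda>t. (snd (v t))\<^sup>2) integrable_on {0..\<tau>}"
      by (auto intro!: integrable_continuous_real continuous_intros cg cx cy cont)
    have const: "((\<lambda>t. k) has_integral \<tau> * k) {0..\<tau>}"
      using has_integral_const_real[of k 0 \<tau>] \<open>0 \<le> \<tau>\<close> by simp
    have "((\<lambda>t. ((1/2) * (g' t)\<^sup>2 + \<epsilon> * (g' t * snd (z t)) + \<epsilon>\<^sup>2 / 2 * ((fst (z t))\<^sup>2 + (snd (z t))\<^sup>2)) / c\<^sup>2
          - (\<mu>\<^sup>2 / 2 * (g t)\<^sup>2 + \<epsilon> * \<mu>\<^sup>2 * (g t * snd (v t)) + \<epsilon>\<^sup>2 / 2 * ((fst (v t))\<^sup>2 + \<mu>\<^sup>2 * (snd (v t))\<^sup>2)) + k)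
        has_integral ((1/2) * integral {0..\<tau>} (\<lambda>t. (g' t)\<^sup>2) + \<epsilon> * integral {0..\<tau>} (\<lambda>t. g' t * snd (z t))
            + \<epsilon>\<^sup>2 / 2 * (integral {0..\<tau>} (\<lambda>t. (fst (z t))\<^sup>2) + integral {0..\<tau>} (\<lambda>t. (snd (z t))\<^sup>2))) / c\<^sup>2
          - (\<mu>\<^sup>2 / 2 * integral {0..\<tau>} (\<lambda>t. (g t)\<^sup>2) + \<epsilon> * \<mu>\<^sup>2 * integral {0..\<tau>} (\<lambda>t. g t * snd (v t))
            + \<epsilon>\<^sup>2 / 2 * (integral {0..\<tau>} (\<lambda>t. (fst (v t))\<^sup>2) + \<mu>\<^sup>2 * integral {0..\<tau>} (\<lambda>t. (snd (v t))\<^sup>2)))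
          + \<tau> * k) {0..\<tau>}"
      by (intro has_integral_add has_integral_diff has_integral_divide has_integral_mult_right
          integrable_integral gg gz zx zy const)
    moreover have "((1/2) * (g' t)\<^sup>2 + \<epsilon> * (g' t * snd (z t)) + \<epsilon>\<^sup>2 / 2 * ((fst (z t))\<^sup>2 + (snd (z t))\<^sup>2)) / c\<^sup>2
          - (\<mu>\<^sup>2 / 2 * (g t)\<^sup>2 + \<epsilon> * \<mu>\<^sup>2 * (g t * snd (v t)) + \<epsilon>\<^sup>2 / 2 * ((fst (v t))\<^sup>2 + \<mu>\<^sup>2 * (snd (v t))\<^sup>2)) + k
        = oscillator_lagrangian \<mu> (?q t) (?p t /\<^sub>R c) + k" for t
    proof -
      have "oscillator_lagrangian \<mu> (?q t) (?p t /\<^sub>R c) =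
          (1/2) * ((\<epsilon> * fst (z t))\<^sup>2 + (g' t + \<epsilon> * snd (z t))\<^sup>2) / c\<^sup>2
          - ((\<epsilon> * fst (v t))\<^sup>2 / 2 + \<mu>\<^sup>2 * ((g t + \<epsilon> * snd (v t))\<^sup>2 / 2))"
      proof -
        have "(x /\<^sub>R c)\<^sup>2 = x\<^sup>2 / c\<^sup>2" for x :: real
          by (simp add: power_mult_distrib power_inverse divide_inverse mult.commute)
        then show ?thesis
          unfolding oscillator_lagrangian_def case_prod_beta fst_scaleR snd_scaleR
          by (simp add: scaleR_fun_def add_divide_distrib)
      qed
      moreover have "(1/2) * ((\<epsilon> * fst (z t))\<^sup>2 + (g' t + \<epsilon> * snd (z t))\<^sup>2)
          = (1/2) * (g' t)\<^sup>2 + \<epsilon> * (g' t * snd (z t)) + \<epsilon>\<^sup>2 / 2 * ((fst (z t))\<^sup>2 + (snd (z t))\<^sup>2)"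
        by (simp add: power2_eq_square algebra_simps)
      moreover have "(\<epsilon> * fst (v t))\<^sup>2 / 2 + \<mu>\<^sup>2 * ((g t + \<epsilon> * snd (v t))\<^sup>2 / 2)
          = \<mu>\<^sup>2 / 2 * (g t)\<^sup>2 + \<epsilon> * \<mu>\<^sup>2 * (g t * snd (v t)) + \<epsilon>\<^sup>2 / 2 * ((fst (v t))\<^sup>2 + \<mu>\<^sup>2 * (snd (v t))\<^sup>2)"
        by (simp add: power2_eq_square algebra_simps)
      ultimately show ?thesis
        by (simp only:)
    qed
    ultimately show "((\<lambda>t. oscillator_lagrangian \<mu> (?q t) (?p t /\<^sub>R c) + k) has_integral
        (P0 + \<epsilon> * P1 + \<epsilon>\<^sup>2 * P2) / c\<^sup>2 - (R0 + \<epsilon> * R1 + \<epsilon>\<^sup>2 * R2) + \<tau> * k) {0..\<tau>}"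
      by (simp add: P0_def P1_def P2_def R0_def R1_def R2_def mult.assoc)
  qed
  finally show ?thesis .
qed

text \<open>A second \<open>deriv\<close> at \<open>a\<close> sees the first one on a whole
  neighbourhood, so the closed formula is required on an open set. For the free-period functional
  this is the set of \<epsilon> with positive period.\<close>

lemma deriv_deriv_eq:
  fixes F G G' :: "real \<Rightarrow> real"
  assumes "\<And>x. x \<in> S \<Longrightarrow> F x = G x" "\<And>x. x \<in> S \<Longrightarrow> (G has_real_derivative G' x) (at x)"
    and "(G' has_real_derivative D) (at a)" "open S" "a \<in> S"
  shows "deriv (deriv F) a = D"
proof -
  have ev: "\<forall>\<^sub>F x in nhds y. x \<in> S" if "y \<in> S" for y
    using \<open>open S\<close> that by (rule eventually_nhds_in_open)
  have "deriv F x = G' x" if "x \<in> S" for x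
  proof -
    have "deriv F x = deriv G x"
      using ev[OF that] by (intro deriv_cong_ev) (auto elim: eventually_mono simp: assms(1))
    then show ?thesis
      using assms(2)[OF that] by (simp add: DERIV_imp_deriv)
  qed
  then have "deriv (deriv F) a = deriv G' a"
    using ev[OF \<open>a \<in> S\<close>] by (intro deriv_cong_ev) (auto elim: eventually_mono)
  then show ?thesis
    using assms(3) by (simp add: DERIV_imp_deriv)
qed

text \<open>Only the coefficient of \<epsilon>^2 survives, and for a quadratic Lagrangian it is the
  same at every base curve; hence \<open>g\<close> is absent from the right-hand side.\<close>

lemma second_variation_action:
  assumes "has_H1_deriv g g' 0 \<tau>" "has_H1_deriv v z 0 \<tau>" "0 \<le> \<tau>" "continuous_on {0..\<tau>} g'"
  shows "second_variation (action (oscillator_lagrangian \<mu>) \<tau>) (\<lambda>t. (0, g t)) v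
    = oscillator_form 1 \<mu> \<tau> v z"
proof -
  define P0 where "P0 = integral {0..\<tau>} (\<lambda>t. (g' t)\<^sup>2) / 2"
  define P1 where "P1 = integral {0..\<tau>} (\<lambda>t. g' t * snd (z t))"
  define P2 where "P2 = (integral {0..\<tau>} (\<lambda>t. (fst (z t))\<^sup>2) + integral {0..\<tau>} (\<lambda>t. (snd (z t))\<^sup>2)) / 2"
  define R0 where "R0 = \<mu>\<^sup>2 * integral {0..\<tau>} (\<lambda>t. (g t)\<^sup>2) / 2"
  define R1 where "R1 = \<mu>\<^sup>2 * integral {0..\<tau>} (\<lambda>t. g t * snd (v t))"
  define R2 where "R2 = (integral {0..\<tau>} (\<lambda>t. (fst (v t))\<^sup>2) + \<mu>\<^sup>2 * integral {0..\<tau>} (\<lambda>t. (snd (v t))\<^sup>2)) / 2"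
  note defs = P0_def P1_def P2_def R0_def R1_def R2_def
  have "second_variation (action (oscillator_lagrangian \<mu>) \<tau>) (\<lambda>t. (0, g t)) v = 2 * P2 - 2 * R2"
    unfolding second_variation_def
  proof (rule deriv_deriv_eq[where S = UNIV])
    show "action (oscillator_lagrangian \<mu>) \<tau> ((\<lambda>t. (0, g t)) + \<epsilon> *\<^sub>R v)
        = (P0 + \<epsilon> * P1 + \<epsilon>\<^sup>2 * P2) - (R0 + \<epsilon> * R1 + \<epsilon>\<^sup>2 * R2)" for \<epsilon>
      using Lagrangian_integral_expansion[OF assms, of \<mu> \<epsilon> 1 0]
      by (simp add: action_def defs)
    show "((\<lambda>\<epsilon>. (P0 + \<epsilon> * P1 + \<epsilon>\<^sup>2 * P2) - (R0 + \<epsilon> * R1 + \<epsilon>\<^sup>2 * R2)) has_real_derivative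
        (P1 + 2 * \<epsilon> * P2) - (R1 + 2 * \<epsilon> * R2)) (at \<epsilon>)" for \<epsilon>
      by (auto intro!: derivative_eq_intros)
    show "((\<lambda>\<epsilon>. (P1 + 2 * \<epsilon> * P2) - (R1 + 2 * \<epsilon> * R2)) has_real_derivative 2 * P2 - 2 * R2) (at 0)"
      by (auto intro!: derivative_eq_intros)
  qed auto
  then show ?thesis
    by (simp add: P2_def R2_def oscillator_form_def field_simps)
qed

text \<open>Along the line the functional is \<open>P \<epsilon> / (T + \<epsilon> * b) + (T +
  \<epsilon> * b) * (k - R \<epsilon>)\<close>. Differentiating twice, the energy drops out because
  it multiplies an affine function. The linear coefficients \<open>P1\<close> and \<open>R1\<close>
  now survive, multiplied by \<open>b\<close>: they couple the variation of the curve to that of the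
  period.\<close>

lemma second_variation_free_period_action:
  assumes "has_H1_deriv g g' 0 1" "has_H1_deriv v z 0 1" "continuous_on {0..1} g'" "T > 0"
  shows "second_variation (free_period_action (oscillator_lagrangian \<mu>) k) (\<lambda>t. (0, g t), T) (v, b)
    = oscillator_form T (T * \<mu>) 1 v z / T
      - 2 * b * (integral {0..1} (\<lambda>t. g' t * snd (z t)) / T\<^sup>2 + \<mu>\<^sup>2 * integral {0..1} (\<lambda>t. g t * snd (v t)))
      + b\<^sup>2 * integral {0..1} (\<lambda>t. (g' t)\<^sup>2) / T^3"
proof -
  define P0 where "P0 = integral {0..1} (\<lambda>t. (g' t)\<^sup>2) / 2"
  define P1 where "P1 = integral {0..1} (\<lambda>t. g' t * snd (z t))"
  define P2 where "P2 = (integral {0..1} (\<lambda>t. (fst (z t))\<^sup>2) + integral {0..1} (\<lambda>t. (snd (z t))\<^sup>2)) / 2"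
  define R0 where "R0 = \<mu>\<^sup>2 * integral {0..1} (\<lambda>t. (g t)\<^sup>2) / 2"
  define R1 where "R1 = \<mu>\<^sup>2 * integral {0..1} (\<lambda>t. g t * snd (v t))"
  define R2 where "R2 = (integral {0..1} (\<lambda>t. (fst (v t))\<^sup>2) + \<mu>\<^sup>2 * integral {0..1} (\<lambda>t. (snd (v t))\<^sup>2)) / 2"
  note defs = P0_def P1_def P2_def R0_def R1_def R2_def
  define S where "S = {\<epsilon>. 0 < T + \<epsilon> * b}"
  define P R where "P \<epsilon> = P0 + \<epsilon> * P1 + \<epsilon>\<^sup>2 * P2" and "R \<epsilon> = R0 + \<epsilon> * R1 + \<epsilon>\<^sup>2 * R2" for \<epsilon>
  define P' R' where "P' \<epsilon> = P1 + 2 * \<epsilon> * P2" and "R' \<epsilon> = R1 + 2 * \<epsilon> * R2" for \<epsilon>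
  have [derivative_intros]: "(P has_real_derivative P' \<epsilon>) (at \<epsilon>)" "(R has_real_derivative R' \<epsilon>) (at \<epsilon>)"
    "(P' has_real_derivative 2 * P2) (at \<epsilon>)" "(R' has_real_derivative 2 * R2) (at \<epsilon>)" for \<epsilon>
    unfolding P_def R_def P'_def R'_def by (auto intro!: derivative_eq_intros)
  have "second_variation (free_period_action (oscillator_lagrangian \<mu>) k) (\<lambda>t. (0, g t), T) (v, b)
      = 2 * P2 / T - 2 * b * P1 / T\<^sup>2 + 2 * b\<^sup>2 * P0 / T^3 - 2 * b * R1 - 2 * T * R2"
    unfolding second_variation_def
  proof (rule deriv_deriv_eq[where S = S])
    show "free_period_action (oscillator_lagrangian \<mu>) k ((\<lambda>t. (0, g t), T) + \<epsilon> *\<^sub>R (v, b))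
        = P \<epsilon> / (T + \<epsilon> * b) + (T + \<epsilon> * b) * (k - R \<epsilon>)" if "\<epsilon> \<in> S" for \<epsilon>
    proof -
      have "free_period_action (oscillator_lagrangian \<mu>) k ((\<lambda>t. (0, g t), T) + \<epsilon> *\<^sub>R (v, b))
          = (T + \<epsilon> * b) * (P \<epsilon> / (T + \<epsilon> * b)\<^sup>2 - R \<epsilon> + k)"
        using Lagrangian_integral_expansion[OF assms(1,2) _ assms(3), of \<mu> \<epsilon> "T + \<epsilon> * b" k]
        by (simp add: free_period_action_def defs P_def R_def)
      also have "(T + \<epsilon> * b) * (P \<epsilon> / (T + \<epsilon> * b)\<^sup>2) = P \<epsilon> / (T + \<epsilon> * b)"
        using that by (simp add: S_def power2_eq_square)
      then have "(T + \<epsilon> * b) * (P \<epsilon> / (T + \<epsilon> * b)\<^sup>2 - R \<epsilon> + k)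
          = P \<epsilon> / (T + \<epsilon> * b) + (T + \<epsilon> * b) * (k - R \<epsilon>)"
        by (simp only: distrib_left right_diff_distrib)
      finally show ?thesis .
    qed
    show "((\<lambda>\<epsilon>. P \<epsilon> / (T + \<epsilon> * b) + (T + \<epsilon> * b) * (k - R \<epsilon>)) has_real_derivative
        (P' \<epsilon> / (T + \<epsilon> * b) - b * P \<epsilon> / (T + \<epsilon> * b)\<^sup>2) + (b * (k - R \<epsilon>) - (T + \<epsilon> * b) * R' \<epsilon>)) (at \<epsilon>)"
      if "\<epsilon> \<in> S" for \<epsilon>
    proof -
      have c: "T + \<epsilon> * b \<noteq> 0"
        using that by (auto simp: S_def)
      have "(P' \<epsilon> * (T + \<epsilon> * b) - P \<epsilon> * b) / ((T + \<epsilon> * b) * (T + \<epsilon> * b))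
          = P' \<epsilon> / (T + \<epsilon> * b) - b * P \<epsilon> / (T + \<epsilon> * b)\<^sup>2"
        using c by (simp add: diff_divide_distrib power2_eq_square mult.commute[of b])
      moreover have "((\<lambda>\<epsilon>. P \<epsilon> / (T + \<epsilon> * b)) has_real_derivative
          (P' \<epsilon> * (T + \<epsilon> * b) - P \<epsilon> * b) / ((T + \<epsilon> * b) * (T + \<epsilon> * b))) (at \<epsilon>)"
        using c by (auto intro!: derivative_eq_intros)
      moreover have "((\<lambda>\<epsilon>. (T + \<epsilon> * b) * (k - R \<epsilon>)) has_real_derivative
          b * (k - R \<epsilon>) - (T + \<epsilon> * b) * R' \<epsilon>) (at \<epsilon>)"
        by (auto intro!: derivative_eq_intros simp: algebra_simps)
      ultimately show ?thesis
        by (simp add: DERIV_add)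
    qed
    have "((\<lambda>\<epsilon>. (P' \<epsilon> / (T + \<epsilon> * b) - b * P \<epsilon> / (T + \<epsilon> * b)\<^sup>2) + (b * (k - R \<epsilon>) - (T + \<epsilon> * b) * R' \<epsilon>))
        has_real_derivative
        ((2 * P2 * T - P' 0 * b) / (T * T) - (b * P' 0 * T\<^sup>2 - b * P 0 * (2 * T * b)) / (T\<^sup>2 * T\<^sup>2))
          + (- b * R' 0 - (b * R' 0 + T * (2 * R2)))) (at 0)"
      using \<open>T > 0\<close> by (auto intro!: derivative_eq_intros)
    moreover have "((2 * P2 * T - P' 0 * b) / (T * T) - (b * P' 0 * T\<^sup>2 - b * P 0 * (2 * T * b)) / (T\<^sup>2 * T\<^sup>2))
          + (- b * R' 0 - (b * R' 0 + T * (2 * R2)))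
        = 2 * P2 / T - 2 * b * P1 / T\<^sup>2 + 2 * b\<^sup>2 * P0 / T^3 - 2 * b * R1 - 2 * T * R2"
      using \<open>T > 0\<close>
      by (simp add: P_def P'_def R'_def) (simp add: field_simps power2_eq_square power3_eq_cube power4_eq_xxxx)
    ultimately show "((\<lambda>\<epsilon>. (P' \<epsilon> / (T + \<epsilon> * b) - b * P \<epsilon> / (T + \<epsilon> * b)\<^sup>2) + (b * (k - R \<epsilon>) - (T + \<epsilon> * b) * R' \<epsilon>))
        has_real_derivative 2 * P2 / T - 2 * b * P1 / T\<^sup>2 + 2 * b\<^sup>2 * P0 / T^3 - 2 * b * R1 - 2 * T * R2) (at 0)"
      by (simp only:)
    show "open S"
      unfolding S_def by (intro open_Collect_less continuous_intros)
    show "0 \<in> S"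
      using \<open>T > 0\<close> by (simp add: S_def)
  qed
  moreover have "2 * P2 / T - 2 * T * R2 = oscillator_form T (T * \<mu>) 1 v z / T"
    using \<open>T > 0\<close> by (simp add: P2_def R2_def oscillator_form_def field_simps power2_eq_square)
  ultimately show ?thesis
    unfolding P0_def[symmetric] P1_def[symmetric] R1_def[symmetric]
    by (simp add: P0_def R1_def algebra_simps)
qed

section \<open>Subspaces of nonnegativity\<close>

lemma second_variation_zero: "second_variation F x 0 = 0"
  by (simp add: second_variation_def)

lemma Wirtinger_form_nonneg:
  fixes u w :: "real \<Rightarrow> real" and n :: nat
  assumes u: "has_H1_deriv u w 0 \<tau>" and "0 < \<tau>" "n > 0" "0 \<le> A" "A * \<tau> \<le> real n * pi"
    and alt: "\<And>j. j < n \<Longrightarrow> u (real (Suc j) * \<tau> / real n) = - u (real j * \<tau> / real n)"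
  shows "0 \<le> integral {0..\<tau>} (\<lambda>t. (w t)\<^sup>2) - A\<^sup>2 * integral {0..\<tau>} (\<lambda>t. (u t)\<^sup>2)"
proof -
  have ac: "abs_cont_deriv u w 0 \<tau>" and w2: "(\<lambda>t. (w t)\<^sup>2) integrable_on {0..\<tau>}"
    using u by (auto simp: has_H1_deriv_abs_cont)
  have "A \<le> real n * pi / \<tau>"
    using assms by (simp add: field_simps)
  then have "A\<^sup>2 \<le> (real n * pi / \<tau>)\<^sup>2"
    using \<open>0 \<le> A\<close> by (rule power_mono)
  moreover have "0 \<le> integral {0..\<tau>} (\<lambda>t. (u t)\<^sup>2)"
    using abs_cont_deriv_continuous[OF ac]
    by (intro integral_nonneg integrable_continuous_real continuous_intros) auto
  ultimately have "A\<^sup>2 * integral {0..\<tau>} (\<lambda>t. (u t)\<^sup>2)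
      \<le> (real n * pi / \<tau>)\<^sup>2 * integral {0..\<tau>} (\<lambda>t. (u t)\<^sup>2)"
    by (rule mult_right_mono)
  also have "\<dots> \<le> integral {0..\<tau>} (\<lambda>t. (w t)\<^sup>2)"
    using ac w2 \<open>0 < \<tau>\<close> \<open>n > 0\<close> alt by (rule Wirtinger_sign_alternating)
  finally show ?thesis
    by simp
qed

text \<open>
  With \<open>2 m\<close> equidistant nodes on the circle, \<open>2 m - 1\<close> conditions already force the values at the
  nodes to alternate in sign: the condition across the base point follows by periodicity.
\<close>

definition alternation_defect :: "nat \<Rightarrow> real \<Rightarrow> nat \<Rightarrow> (real \<Rightarrow> real \<times> real) \<Rightarrow> real"
  where "alternation_defect m \<tau> i v =
    (if Suc i < 2 * m
     then fst (v (real (Suc i) * \<tau> / real (2 * m))) + fst (v (real i * \<tau> / real (2 * m)))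
     else snd (v (\<tau> / 2)) + snd (v 0))"

lemma linear_alternation_defect: "linear (alternation_defect m \<tau> i)"
  by (rule linearI) (auto simp: alternation_defect_def scaleR_fun_def algebra_simps)

text \<open>Each component gets the number of nodes fitting its own coefficient, 2 m for
  \<open>A\<close> and two for \<open>B\<close>. The defects with index below 2 m - 1 concern the
  horizontal component, the last one the vertical component.\<close>

lemma oscillator_form_nonneg_periodic:
  assumes "v \<in> H1_periodic \<tau>" and v: "has_H1_deriv v z 0 \<tau>" and "0 < \<tau>" "m > 0"
    and "0 \<le> A" "A * \<tau> \<le> real (2 * m) * pi" "0 \<le> B" "B * \<tau> \<le> 2 * pi"
    and defect: "\<And>i. i < 2 * m \<Longrightarrow> alternation_defect m \<tau> i v = 0"
  shows "0 \<le> oscillator_form A B \<tau> v z"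
proof -
  have per: "v \<tau> = v 0"
    using assms(1) unfolding H1_periodic_def by (auto dest: spec[of _ 0])
  have vx: "has_H1_deriv (\<lambda>t. fst (v t)) (\<lambda>t. fst (z t)) 0 \<tau>"
    and vy: "has_H1_deriv (\<lambda>t. snd (v t)) (\<lambda>t. snd (z t)) 0 \<tau>"
    using v by (auto simp: has_H1_deriv_components[of v])
  define p where "p j = fst (v (real j * \<tau> / real (2 * m)))" for j
  have step: "p (Suc j) = - p j" if "Suc j < 2 * m" for j
    using defect[of j] that unfolding alternation_defect_def p_def by simp
  have "p j = (-1) ^ j * p 0" if "j < 2 * m" for j
    using that by (induction j) (use step in auto)
  \<comment> \<open>The even number of nodes matters: 2 m - 1 sign changes lead to
    \<open>- p 0\<close>, so the step back to \<open>p 0\<close> at \<tau> is again a sign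
    change.\<close>
  from this[of "2 * m - 1"] have "p (2 * m - 1) = - p 0"
    using \<open>m > 0\<close> by (simp add: uminus_power_if)
  moreover have "p (2 * m) = p 0"
    using per \<open>m > 0\<close> by (simp add: p_def)
  ultimately have last: "p (Suc j) = - p j" if "j = 2 * m - 1" for j
    using that \<open>m > 0\<close> by simp
  have "p (Suc j) = - p j" if "j < 2 * m" for j
    using step[of j] last[of j] that by (cases "Suc j < 2 * m") (blast, fastforce)
  then have x: "0 \<le> integral {0..\<tau>} (\<lambda>t. (fst (z t))\<^sup>2) - A\<^sup>2 * integral {0..\<tau>} (\<lambda>t. (fst (v t))\<^sup>2)"
    using assms vx by (intro Wirtinger_form_nonneg[where n = "2 * m"]) (auto simp: p_def)
  have "snd (v (\<tau> / 2)) = - snd (v 0)"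
    using defect[of "2 * m - 1"] \<open>m > 0\<close> by (simp add: alternation_defect_def)
  then have "snd (v (real (Suc j) * \<tau> / real 2)) = - snd (v (real j * \<tau> / real 2))" if "j < 2" for j
    using that per by (auto simp: less_2_cases_iff)
  then have "0 \<le> integral {0..\<tau>} (\<lambda>t. (snd (z t))\<^sup>2) - B\<^sup>2 * integral {0..\<tau>} (\<lambda>t. (snd (v t))\<^sup>2)"
    using assms vy by (intro Wirtinger_form_nonneg[where n = 2]) auto
  with x show ?thesis
    by (simp add: oscillator_form_def)
qed

text \<open>Index 0 would stand for the left end point, where Dirichlet variations vanish anyway.
  Its slot carries the single vertical condition, at the midpoint, which makes n conditions in
  all.\<close>

definition node_value :: "nat \<Rightarrow> real \<Rightarrow> nat \<Rightarrow> (real \<Rightarrow> real \<times> real) \<Rightarrow> real"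
  where "node_value n \<tau> i v = (if i = 0 then snd (v (\<tau> / 2)) else fst (v (real i * \<tau> / real n)))"

lemma linear_node_value: "linear (node_value n \<tau> i)"
  by (rule linearI) (auto simp: node_value_def scaleR_fun_def)

text \<open>A function that vanishes at all nodes alternates in sign there, so the same Wirtinger
  bound applies, with the end points contributing two nodes for free.\<close>

lemma oscillator_form_nonneg_Dirichlet:
  assumes "v \<in> H1_Dirichlet \<tau>" and v: "has_H1_deriv v z 0 \<tau>" and "0 < \<tau>" "n > 0"
    and "0 \<le> A" "A * \<tau> \<le> real n * pi" "0 \<le> B" "B * \<tau> \<le> 2 * pi"
    and node: "\<And>i. i < n \<Longrightarrow> node_value n \<tau> i v = 0"
  shows "0 \<le> oscillator_form A B \<tau> v z"
proof -
  have ends: "v 0 = 0" "v \<tau> = 0"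
    using assms(1) by (auto simp: H1_Dirichlet_def)
  have vx: "has_H1_deriv (\<lambda>t. fst (v t)) (\<lambda>t. fst (z t)) 0 \<tau>"
    and vy: "has_H1_deriv (\<lambda>t. snd (v t)) (\<lambda>t. snd (z t)) 0 \<tau>"
    using v by (auto simp: has_H1_deriv_components[of v])
  have zero: "fst (v (real j * \<tau> / real n)) = 0" if "j \<le> n" for j
  proof -
    consider "j = 0" | "j = n" | "0 < j" "j < n"
      using \<open>j \<le> n\<close> by linarith
    then show ?thesis
      using ends node[of j] \<open>n > 0\<close> by cases (auto simp: node_value_def)
  qed
  then have x: "0 \<le> integral {0..\<tau>} (\<lambda>t. (fst (z t))\<^sup>2) - A\<^sup>2 * integral {0..\<tau>} (\<lambda>t. (fst (v t))\<^sup>2)"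
    using assms vx zero[of "Suc _"] by (intro Wirtinger_form_nonneg[where n = n]) (auto simp del: of_nat_Suc)
  have "snd (v (\<tau> / 2)) = 0"
    using node[of 0] \<open>n > 0\<close> by (simp add: node_value_def)
  then have "snd (v (real (Suc j) * \<tau> / real 2)) = - snd (v (real j * \<tau> / real 2))" if "j < 2" for j
    using that ends by (auto simp: less_2_cases_iff)
  then have "0 \<le> integral {0..\<tau>} (\<lambda>t. (snd (z t))\<^sup>2) - B\<^sup>2 * integral {0..\<tau>} (\<lambda>t. (snd (v t))\<^sup>2)"
    using assms vy by (intro Wirtinger_form_nonneg[where n = 2]) auto
  with x show ?thesis
    by (simp add: oscillator_form_def)
qed

section \<open>Negative directions\<close>

lemma has_integral_orthogonal_sum_square:
  fixes f :: "'i \<Rightarrow> real \<Rightarrow> real"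
  assumes "finite I"
    and orth: "\<And>i j. \<lbrakk>i \<in> I; j \<in> I\<rbrakk> \<Longrightarrow> ((\<lambda>t. f i t * f j t) has_integral (if i = j then s else 0)) S"
  shows "((\<lambda>t. (\<Sum>i\<in>I. c i * f i t)\<^sup>2) has_integral (s * (\<Sum>i\<in>I. (c i)\<^sup>2))) S"
proof -
  have "((\<lambda>t. \<Sum>i\<in>I. \<Sum>j\<in>I. c i * c j * (f i t * f j t)) has_integral
      (\<Sum>i\<in>I. \<Sum>j\<in>I. c i * c j * (if i = j then s else 0))) S"
    using assms by (intro has_integral_sum has_integral_mult_right) auto
  moreover have "(\<Sum>i\<in>I. \<Sum>j\<in>I. c i * c j * (f i t * f j t)) = (\<Sum>i\<in>I. c i * f i t)\<^sup>2" for t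
    by (simp add: power2_eq_square sum_product mult.assoc mult.left_commute)
  moreover have "(\<Sum>i\<in>I. \<Sum>j\<in>I. c i * c j * (if i = j then s else 0)) = s * (\<Sum>i\<in>I. (c i)\<^sup>2)"
    using \<open>finite I\<close>
    by (simp add: power2_eq_square sum_distrib_left mult.commute mult.left_commute if_distrib cong: if_cong)
  ultimately show ?thesis
    by simp
qed

lemma has_integral_cos_half_period:
  fixes n :: int
  assumes "0 < \<tau>"
  shows "((\<lambda>t. cos (pi * n / \<tau> * t)) has_integral (if n = 0 then \<tau> else 0)) {0..\<tau>}"
proof (cases "n = 0")
  case True
  then show ?thesis
    using has_integral_const_real[of "1::real" 0 \<tau>] assms by simp
next
  case False
  define \<nu> where "\<nu> = pi * n / \<tau>"
  have \<nu>: "\<nu> \<noteq> 0" "\<nu> * \<tau> = n * pi"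
    using False assms by (auto simp: \<nu>_def)
  have "((\<lambda>t. cos (\<nu> * t)) has_integral (sin (\<nu> * \<tau>) / \<nu> - sin (\<nu> * 0) / \<nu>)) {0..\<tau>}"
    using assms \<nu> by (intro fundamental_theorem_of_calculus)
      (auto intro!: derivative_eq_intros simp flip: has_real_derivative_iff_has_vector_derivative)
  moreover have "sin (\<nu> * \<tau>) = 0"
    unfolding \<nu> by (simp add: sin_zero_iff_int2)
  ultimately show ?thesis
    using False by (simp add: \<nu>_def)
qed

text \<open>The frequency step is twice that of the cosine lemma: over an odd number of half periods
  a sine does not integrate to zero.\<close>

lemma has_integral_sin_full_period:
  fixes n :: int
  assumes "0 < \<tau>"
  shows "((\<lambda>t. sin (2 * pi * n / \<tau> * t)) has_integral 0) {0..\<tau>}"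
proof (cases "n = 0")
  case True
  then show ?thesis by simp
next
  case False
  define \<nu> where "\<nu> = 2 * pi * n / \<tau>"
  have \<nu>: "\<nu> \<noteq> 0" "\<nu> * \<tau> = n * (2 * pi)"
    using False assms by (auto simp: \<nu>_def)
  have "((\<lambda>t. sin (\<nu> * t)) has_integral (- cos (\<nu> * \<tau>) / \<nu> - - cos (\<nu> * 0) / \<nu>)) {0..\<tau>}"
    using assms \<nu> by (intro fundamental_theorem_of_calculus)
      (auto intro!: derivative_eq_intros simp flip: has_real_derivative_iff_has_vector_derivative)
  moreover have "cos (\<nu> * \<tau>) = 1"
    unfolding \<nu> by (metis cos_int_2pin mult.commute)
  ultimately show ?thesis
    by (simp add: \<nu>_def)
qed

text \<open>
  Hartley's kernel: a single family indexed by the integers, orthogonal over a period, whose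
  derivatives are multiples of its members.
\<close>

definition cas :: "real \<Rightarrow> int \<Rightarrow> real \<Rightarrow> real"
  where "cas \<tau> n t = cos (2 * pi * n / \<tau> * t) + sin (2 * pi * n / \<tau> * t)"

lemma DERIV_cas: "(cas \<tau> n has_real_derivative 2 * pi * n / \<tau> * cas \<tau> (- n) t) (at t)"
proof -
  have "((\<lambda>t. cos (\<nu> * t) + sin (\<nu> * t)) has_real_derivative \<nu> * (cos (\<nu> * t) - sin (\<nu> * t))) (at t)" for \<nu>
    by (auto intro!: derivative_eq_intros simp: algebra_simps)
  from this[of "2 * pi * n / \<tau>"] show ?thesis
    by (simp add: cas_def[abs_def])
qed

lemma continuous_on_cas [continuous_intros]: "continuous_on S (cas \<tau> n)"
  unfolding cas_def by (intro continuous_intros)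

lemma cas_periodic:
  assumes "0 < \<tau>"
  shows "cas \<tau> n (t + \<tau>) = cas \<tau> n t"
proof -
  have *: "2 * pi * n / \<tau> * (t + \<tau>) = 2 * pi * n / \<tau> * t + 2 * pi * n"
    using assms by (simp add: field_simps)
  have "sin (2 * pi * real_of_int n) = 0" "cos (2 * pi * real_of_int n) = 1"
    by (simp_all add: sin_int_2pin cos_int_2pin)
  then show ?thesis
    unfolding cas_def * sin_add cos_add by simp
qed

text \<open>The product formula is cas x cas y = cos (x - y) + sin (x + y). The sine always
  integrates to zero over full periods, and the cosine survives only for equal indices, so no
  separate sine and cosine cases arise.\<close>

lemma has_integral_cas_mult:
  assumes "0 < \<tau>"
  shows "((\<lambda>t. cas \<tau> n t * cas \<tau> k t) has_integral (if n = k then \<tau> else 0)) {0..\<tau>}"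
proof -
  have "((\<lambda>t. cos (pi * (2 * (n - k)) / \<tau> * t) + sin (2 * pi * (n + k) / \<tau> * t)) has_integral
      ((if 2 * (n - k) = 0 then \<tau> else 0) + 0)) {0..\<tau>}"
    using has_integral_cos_half_period[OF assms, of "2 * (n - k)"]
      has_integral_sin_full_period[OF assms, of "n + k"]
    by (intro has_integral_add) auto
  moreover have "cos (pi * (2 * (n - k)) / \<tau> * t) + sin (2 * pi * (n + k) / \<tau> * t)
      = cas \<tau> n t * cas \<tau> k t" for t
  proof -
    define x y where "x = 2 * pi * n / \<tau> * t" and "y = 2 * pi * k / \<tau> * t"
    have *: "pi * (2 * (n - k)) / \<tau> * t = x - y" "2 * pi * (n + k) / \<tau> * t = x + y"
      by (simp_all add: x_def y_def algebra_simps add_divide_distrib diff_divide_distrib)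
    show ?thesis
      unfolding cas_def * x_def[symmetric] y_def[symmetric]
      by (simp add: cos_diff sin_add algebra_simps)
  qed
  ultimately show ?thesis
    by simp
qed

section \<open>Trigonometric modes of the periodic problems\<close>

definition periodic_mode :: "real \<Rightarrow> int option \<Rightarrow> real \<Rightarrow> real \<times> real"
  where "periodic_mode \<tau> i = (case i of None \<Rightarrow> (\<lambda>t. (0, 1)) | Some n \<Rightarrow> (\<lambda>t. (cas \<tau> n t, 0)))"

text \<open>The general element of the test spaces: \<open>c\<close> collects the horizontal modes,
  \<open>d\<close> is the vertical constant, and \<open>r\<close> the first vertical cosine. The
  last one enters together with a variation of the period; fixed-time test fields have
  \<open>r = 0\<close>.\<close>

definition periodic_field :: "real \<Rightarrow> int set \<Rightarrow> (int \<Rightarrow> real) \<Rightarrow> real \<Rightarrow> real \<Rightarrow> real \<Rightarrow> real \<times> real"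
  where "periodic_field \<tau> I c d r t = (\<Sum>n\<in>I. c n * cas \<tau> n t, d + r * cos (2 * pi / \<tau> * t))"

definition periodic_field_deriv :: "real \<Rightarrow> int set \<Rightarrow> (int \<Rightarrow> real) \<Rightarrow> real \<Rightarrow> real \<Rightarrow> real \<times> real"
  where "periodic_field_deriv \<tau> I c r t =
    (\<Sum>n\<in>I. (2 * pi * n / \<tau> * c n) * cas \<tau> (- n) t, r * - (2 * pi / \<tau> * sin (2 * pi / \<tau> * t)))"

lemma DERIV_cos_scaled:
  "((\<lambda>t. a * cos (\<omega> * t)) has_real_derivative a * - (\<omega> * sin (\<omega> * t))) (at t)"
  by (auto intro!: derivative_eq_intros)

lemma has_H1_deriv_periodic_field:
  "has_H1_deriv (periodic_field \<tau> I c d r) (periodic_field_deriv \<tau> I c r) a b"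
proof (intro has_H1_deriv_components[THEN iffD2] conjI has_H1_deriv_smooth)
  fix t
  have "((\<lambda>t. \<Sum>n\<in>I. c n * cas \<tau> n t) has_real_derivative
      (\<Sum>n\<in>I. c n * (2 * pi * n / \<tau> * cas \<tau> (- n) t))) (at t)"
    by (intro DERIV_sum DERIV_cmult DERIV_cas)
  then show "((\<lambda>t. fst (periodic_field \<tau> I c d r t)) has_real_derivative
      fst (periodic_field_deriv \<tau> I c r t)) (at t)"
    by (simp add: periodic_field_def periodic_field_deriv_def mult.assoc mult.left_commute)
  show "((\<lambda>t. snd (periodic_field \<tau> I c d r t)) has_real_derivative
      snd (periodic_field_deriv \<tau> I c r t)) (at t)"
    using DERIV_add[OF DERIV_const[of d] DERIV_cos_scaled[of r "2 * pi / \<tau>"]]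
    by (simp add: periodic_field_def periodic_field_deriv_def)
qed (unfold periodic_field_deriv_def fst_conv snd_conv,
    (intro continuous_on_sum continuous_on_mult_left continuous_on_minus continuous_on_sin
      continuous_on_cas continuous_on_id)+)

lemma periodic_field_in_H1_periodic:
  assumes "0 < \<tau>"
  shows "periodic_field \<tau> I c d r \<in> H1_periodic \<tau>"
proof -
  have "cos (2 * pi / \<tau> * (t + \<tau>)) = cos (2 * pi / \<tau> * t)" for t
    using assms by (simp add: distrib_left)
  then show ?thesis
    using has_H1_deriv_periodic_field[of \<tau> I c d r 0 \<tau>] assms
    unfolding H1_periodic_def by (auto simp: periodic_field_def cas_periodic)
qed

lemma has_integral_cos_square:
  assumes "0 < \<tau>"
  shows "((\<lambda>t. (cos (2 * pi / \<tau> * t))\<^sup>2) has_integral \<tau> / 2) {0..\<tau>}"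
    and "((\<lambda>t. (sin (2 * pi / \<tau> * t))\<^sup>2) has_integral \<tau> / 2) {0..\<tau>}"
    and "((\<lambda>t. cos (2 * pi / \<tau> * t)) has_integral 0) {0..\<tau>}"
proof -
  have one: "((\<lambda>t. 1::real) has_integral \<tau>) {0..\<tau>}"
    using has_integral_const_real[of "1::real" 0 \<tau>] assms by simp
  have c: "((\<lambda>t. cos (pi * real_of_int 4 / \<tau> * t)) has_integral 0) {0..\<tau>}"
    using has_integral_cos_half_period[OF assms, of 4] by simp
  have eq: "pi * real_of_int 4 / \<tau> * t = 2 * (2 * pi / \<tau> * t)" for t
    by simp
  have "((\<lambda>t. (1 + cos (2 * (2 * pi / \<tau> * t))) / 2) has_integral ((\<tau> + 0) / 2)) {0..\<tau>}"
    using c unfolding eq by (intro has_integral_divide has_integral_add one)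
  moreover have "(1 + cos (2 * x)) / 2 = (cos x)\<^sup>2" for x :: real
    by (simp add: cos_double_cos)
  ultimately show "((\<lambda>t. (cos (2 * pi / \<tau> * t))\<^sup>2) has_integral \<tau> / 2) {0..\<tau>}"
    by (simp only: add_0_right)
  have "((\<lambda>t. (1 - cos (2 * (2 * pi / \<tau> * t))) / 2) has_integral ((\<tau> - 0) / 2)) {0..\<tau>}"
    using c unfolding eq by (intro has_integral_divide has_integral_diff one)
  moreover have "(1 - cos (2 * x)) / 2 = (sin x)\<^sup>2" for x :: real
    by (simp add: cos_double_sin)
  ultimately show "((\<lambda>t. (sin (2 * pi / \<tau> * t))\<^sup>2) has_integral \<tau> / 2) {0..\<tau>}"
    by (simp only: diff_zero)
  show "((\<lambda>t. cos (2 * pi / \<tau> * t)) has_integral 0) {0..\<tau>}"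
    using has_integral_cos_half_period[OF assms, of 2] by (simp add: mult.commute)
qed

text \<open>These modes diagonalise the form. For \<open>B * \<tau> = 2 * pi\<close> the coefficient
  of r^2 vanishes: the first vertical cosine is then a null direction.\<close>

lemma oscillator_form_periodic_field:
  assumes "0 < \<tau>" "finite I"
  shows "oscillator_form A B \<tau> (periodic_field \<tau> I c d r) (periodic_field_deriv \<tau> I c r)
    = \<tau> * (\<Sum>n\<in>I. ((2 * pi * n / \<tau>)\<^sup>2 - A\<^sup>2) * (c n)\<^sup>2)
      + (\<tau> / 2 * ((2 * pi / \<tau>)\<^sup>2 - B\<^sup>2) * r\<^sup>2 - \<tau> * B\<^sup>2 * d\<^sup>2)"
proof -
  define \<omega> where "\<omega> = 2 * pi / \<tau>"
  note cs = has_integral_cos_square[OF \<open>0 < \<tau>\<close>, folded \<omega>_def]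
  have one: "((\<lambda>t. d\<^sup>2) has_integral d\<^sup>2 * \<tau>) {0..\<tau>}"
    using has_integral_const_real[of "d\<^sup>2" 0 \<tau>] assms by (simp add: mult.commute)
  have x: "integral {0..\<tau>} (\<lambda>t. (fst (periodic_field \<tau> I c d r t))\<^sup>2) = \<tau> * (\<Sum>n\<in>I. (c n)\<^sup>2)"
    unfolding periodic_field_def fst_conv using assms
    by (intro integral_unique has_integral_orthogonal_sum_square has_integral_cas_mult)
  have orth: "((\<lambda>t. cas \<tau> (- n) t * cas \<tau> (- k) t) has_integral (if n = k then \<tau> else 0)) {0..\<tau>}" for n k
    using has_integral_cas_mult[OF \<open>0 < \<tau>\<close>, of "- n" "- k"] by simp
  have x': "integral {0..\<tau>} (\<lambda>t. (fst (periodic_field_deriv \<tau> I c r t))\<^sup>2)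
      = \<tau> * (\<Sum>n\<in>I. (2 * pi * n / \<tau> * c n)\<^sup>2)"
    unfolding periodic_field_deriv_def fst_conv using assms
    by (intro integral_unique has_integral_orthogonal_sum_square orth)
  have "((\<lambda>t. d\<^sup>2 + 2 * d * r * cos (\<omega> * t) + r\<^sup>2 * (cos (\<omega> * t))\<^sup>2) has_integral
      d\<^sup>2 * \<tau> + 2 * d * r * 0 + r\<^sup>2 * (\<tau> / 2)) {0..\<tau>}"
    by (intro has_integral_add has_integral_mult_right cs one)
  then have y: "integral {0..\<tau>} (\<lambda>t. (snd (periodic_field \<tau> I c d r t))\<^sup>2) = d\<^sup>2 * \<tau> + r\<^sup>2 * (\<tau> / 2)"
    unfolding periodic_field_def snd_conv \<omega>_def[symmetric]
    by (intro integral_unique) (simp add: power2_sum algebra_simps power_mult_distrib)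
  have "((\<lambda>t. (r * \<omega>)\<^sup>2 * (sin (\<omega> * t))\<^sup>2) has_integral (r * \<omega>)\<^sup>2 * (\<tau> / 2)) {0..\<tau>}"
    by (intro has_integral_mult_right cs)
  then have y': "integral {0..\<tau>} (\<lambda>t. (snd (periodic_field_deriv \<tau> I c r t))\<^sup>2) = (r * \<omega>)\<^sup>2 * (\<tau> / 2)"
    unfolding periodic_field_deriv_def snd_conv \<omega>_def[symmetric]
    by (intro integral_unique) (simp add: power_mult_distrib mult.assoc)
  have "\<tau> * (\<Sum>n\<in>I. (2 * pi * n / \<tau> * c n)\<^sup>2) - A\<^sup>2 * (\<tau> * (\<Sum>n\<in>I. (c n)\<^sup>2))
      = \<tau> * ((\<Sum>n\<in>I. (2 * pi * n / \<tau> * c n)\<^sup>2) - (\<Sum>n\<in>I. A\<^sup>2 * (c n)\<^sup>2))"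
    by (simp add: right_diff_distrib sum_distrib_left[symmetric])
  also have "\<dots> = \<tau> * (\<Sum>n\<in>I. ((2 * pi * n / \<tau>)\<^sup>2 - A\<^sup>2) * (c n)\<^sup>2)"
    by (simp only: power_mult_distrib left_diff_distrib sum_subtractf)
  finally have x_part: "\<tau> * (\<Sum>n\<in>I. (2 * pi * n / \<tau> * c n)\<^sup>2) - A\<^sup>2 * (\<tau> * (\<Sum>n\<in>I. (c n)\<^sup>2))
      = \<tau> * (\<Sum>n\<in>I. ((2 * pi * n / \<tau>)\<^sup>2 - A\<^sup>2) * (c n)\<^sup>2)" .
  have y_part: "(r * \<omega>)\<^sup>2 * (\<tau> / 2) - B\<^sup>2 * (d\<^sup>2 * \<tau> + r\<^sup>2 * (\<tau> / 2))
      = \<tau> / 2 * (\<omega>\<^sup>2 - B\<^sup>2) * r\<^sup>2 - \<tau> * B\<^sup>2 * d\<^sup>2"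
    by (simp add: power_mult_distrib algebra_simps)
  show ?thesis
    unfolding oscillator_form_def x x' y y' \<omega>_def[symmetric]
    by (simp only: x_part[folded \<omega>_def] y_part)
qed

lemma sum_insert_None:
  fixes f :: "'i option \<Rightarrow> 'b::comm_monoid_add"
  assumes "finite I"
  shows "(\<Sum>i\<in>insert None (Some ` I). f i) = f None + (\<Sum>n\<in>I. f (Some n))"
  using assms by (simp add: sum.reindex)

lemma sum_periodic_mode:
  assumes "finite I"
  shows "(\<Sum>i\<in>insert None (Some ` I). c i *\<^sub>R periodic_mode \<tau> i)
    = periodic_field \<tau> I (\<lambda>n. c (Some n)) (c None) 0"
proof
  fix t
  show "(\<Sum>i\<in>insert None (Some ` I). c i *\<^sub>R periodic_mode \<tau> i) t
      = periodic_field \<tau> I (\<lambda>n. c (Some n)) (c None) 0 t"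
    unfolding sum_insert_None[OF assms] plus_fun_apply sum_fun_apply
    by (simp add: periodic_mode_def periodic_field_def scaleR_fun_def fst_sum snd_sum prod_eq_iff)
qed

lemma mode_sum_neg:
  fixes c :: "'i \<Rightarrow> real"
  assumes "finite I" "\<And>n. n \<in> I \<Longrightarrow> q n < 0"
  shows "(\<Sum>n\<in>I. q n * (c n)\<^sup>2) \<le> 0" and "\<lbrakk>n \<in> I; c n \<noteq> 0\<rbrakk> \<Longrightarrow> (\<Sum>n\<in>I. q n * (c n)\<^sup>2) < 0"
proof -
  have le: "q n * (c n)\<^sup>2 \<le> 0" if "n \<in> I" for n
    using assms(2)[OF that] by (intro mult_nonpos_nonneg) auto
  then show "(\<Sum>n\<in>I. q n * (c n)\<^sup>2) \<le> 0"
    by (intro sum_nonpos)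
  assume n: "n \<in> I" "c n \<noteq> 0"
  have "(\<Sum>n\<in>I. q n * (c n)\<^sup>2) < (\<Sum>n\<in>I. 0)"
    using \<open>finite I\<close> le n assms(2)[of n]
    by (intro sum_strict_mono_ex1) (auto intro!: bexI[of _ n] mult_neg_pos)
  then show "(\<Sum>n\<in>I. q n * (c n)\<^sup>2) < 0"
    by simp
qed

text \<open>\<open>I\<close> holds the 2 m - 1 frequencies of absolute value below m, the largest of
  which still lies below \<open>A\<close>. The vertical cosine drops out by resonance, so strict
  negativity needs another coefficient. The weak bound serves the free-period problem, where
  strictness may come from the period instead.\<close>

lemma oscillator_form_periodic_field_bounds:
  fixes m :: nat
  assumes "0 < \<tau>" "0 \<le> A" "B * \<tau> = 2 * pi" "2 * pi * (real m - 1) < A * \<tau>"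
  defines "I \<equiv> {- (int m - 1)..int m - 1}"
  shows "oscillator_form A B \<tau> (periodic_field \<tau> I c d r) (periodic_field_deriv \<tau> I c r) \<le> 0"
    and "d \<noteq> 0 \<or> (\<exists>n\<in>I. c n \<noteq> 0) \<Longrightarrow>
      oscillator_form A B \<tau> (periodic_field \<tau> I c d r) (periodic_field_deriv \<tau> I c r) < 0"
proof -
  have B: "2 * pi / \<tau> = B" "B \<noteq> 0"
    using assms by (auto simp: field_simps)
  have "finite I"
    by (simp add: I_def)
  have q: "(2 * pi * n / \<tau>)\<^sup>2 - A\<^sup>2 < 0" if "n \<in> I" for n :: int
  proof -
    have "\<bar>real_of_int n\<bar> \<le> real m - 1"
      using that by (auto simp: I_def)
    then have "2 * pi * \<bar>real_of_int n\<bar> \<le> 2 * pi * (real m - 1)"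
      by (intro mult_left_mono) auto
    then have "2 * pi * \<bar>real_of_int n\<bar> / \<tau> < A"
      using assms by (simp add: field_simps)
    then have "\<bar>2 * pi * n / \<tau>\<bar>\<^sup>2 < A\<^sup>2"
      using assms by (intro power_strict_mono) (auto simp: abs_mult)
    then show ?thesis
      by (simp only: power2_abs)
  qed
  define X where "X = (\<Sum>n\<in>I. ((2 * pi * n / \<tau>)\<^sup>2 - A\<^sup>2) * (c n)\<^sup>2)"
  have form: "oscillator_form A B \<tau> (periodic_field \<tau> I c d r) (periodic_field_deriv \<tau> I c r)
      = \<tau> * X - \<tau> * B\<^sup>2 * d\<^sup>2"
    using oscillator_form_periodic_field[OF \<open>0 < \<tau>\<close> \<open>finite I\<close>, of A B c d r] B(1) by (simp add: X_def)
  have X: "\<tau> * X \<le> 0"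
    using mode_sum_neg(1)[OF \<open>finite I\<close> q] \<open>0 < \<tau>\<close> unfolding X_def
    by (intro mult_nonneg_nonpos) auto
  have D: "0 \<le> \<tau> * B\<^sup>2 * d\<^sup>2"
    using \<open>0 < \<tau>\<close> by simp
  show "oscillator_form A B \<tau> (periodic_field \<tau> I c d r) (periodic_field_deriv \<tau> I c r) \<le> 0"
    using X D form by linarith
  assume "d \<noteq> 0 \<or> (\<exists>n\<in>I. c n \<noteq> 0)"
  then show "oscillator_form A B \<tau> (periodic_field \<tau> I c d r) (periodic_field_deriv \<tau> I c r) < 0"
  proof
    assume "d \<noteq> 0"
    then have "0 < \<tau> * B\<^sup>2 * d\<^sup>2"
      using \<open>0 < \<tau>\<close> B by simp
    then show ?thesis
      using X form by linarith
  next
    assume "\<exists>n\<in>I. c n \<noteq> 0"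
    then obtain n where "n \<in> I" "c n \<noteq> 0"
      by blast
    then have "X < 0"
      unfolding X_def by (intro mode_sum_neg(2)[OF \<open>finite I\<close> q])
    then have "\<tau> * X < 0"
      using \<open>0 < \<tau>\<close> by (rule mult_pos_neg[rotated])
    then show ?thesis
      using D form by linarith
  qed
qed

section \<open>Sine modes of the Dirichlet problem\<close>

lemma has_integral_trig_half_period_mult:
  fixes n k :: int
  assumes "0 < \<tau>" "0 < n" "0 < k"
  shows "((\<lambda>t. sin (pi * n / \<tau> * t) * sin (pi * k / \<tau> * t)) has_integral (if n = k then \<tau> / 2 else 0)) {0..\<tau>}"
    and "((\<lambda>t. cos (pi * n / \<tau> * t) * cos (pi * k / \<tau> * t)) has_integral (if n = k then \<tau> / 2 else 0)) {0..\<tau>}"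
proof -
  have *: "pi * (n - k) / \<tau> * t = pi * n / \<tau> * t - pi * k / \<tau> * t"
    "pi * (n + k) / \<tau> * t = pi * n / \<tau> * t + pi * k / \<tau> * t" for t
    by (simp_all add: algebra_simps add_divide_distrib diff_divide_distrib)
  have d: "((\<lambda>t. cos (pi * n / \<tau> * t - pi * k / \<tau> * t)) has_integral (if n = k then \<tau> else 0)) {0..\<tau>}"
    using has_integral_cos_half_period[OF \<open>0 < \<tau>\<close>, of "n - k"] unfolding * by simp
  \<comment> \<open>Positive indices keep n + k away from 0, so the cosine of the sum never
    contributes.\<close>
  have s: "((\<lambda>t. cos (pi * n / \<tau> * t + pi * k / \<tau> * t)) has_integral 0) {0..\<tau>}"
    using has_integral_cos_half_period[OF \<open>0 < \<tau>\<close>, of "n + k"] assms unfolding * by simp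
  have "((\<lambda>t. (cos (pi * n / \<tau> * t - pi * k / \<tau> * t) - cos (pi * n / \<tau> * t + pi * k / \<tau> * t)) / 2)
      has_integral ((if n = k then \<tau> else 0) - 0) / 2) {0..\<tau>}"
    by (intro has_integral_divide has_integral_diff d s)
  then show "((\<lambda>t. sin (pi * n / \<tau> * t) * sin (pi * k / \<tau> * t)) has_integral (if n = k then \<tau> / 2 else 0)) {0..\<tau>}"
    unfolding sin_times_sin by (rule has_integral_eq_rhs) simp
  have "((\<lambda>t. (cos (pi * n / \<tau> * t - pi * k / \<tau> * t) + cos (pi * n / \<tau> * t + pi * k / \<tau> * t)) / 2)
      has_integral ((if n = k then \<tau> else 0) + 0) / 2) {0..\<tau>}"
    by (intro has_integral_divide has_integral_add d s)
  then show "((\<lambda>t. cos (pi * n / \<tau> * t) * cos (pi * k / \<tau> * t)) has_integral (if n = k then \<tau> / 2 else 0)) {0..\<tau>}"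
    unfolding cos_times_cos by (rule has_integral_eq_rhs) simp
qed

lemma has_H1_deriv_cong:
  assumes "\<And>t. t \<in> {a..b} \<Longrightarrow> u t = v t"
  shows "has_H1_deriv u w a b \<longleftrightarrow> has_H1_deriv v w a b"
proof -
  have "u t - u a = v t - v a" if "t \<in> {a..b}" for t
    using assms[of t] assms[of a] that by simp
  then show ?thesis
    unfolding has_H1_deriv_def by simp
qed

text \<open>The cut-off outside [0, \<tau>] matches the extension by zero demanded by
  \<open>H1_Dirichlet\<close>. The single vertical mode is the half-wave sine.\<close>

definition Dirichlet_mode :: "real \<Rightarrow> int option \<Rightarrow> real \<Rightarrow> real \<times> real"
  where "Dirichlet_mode \<tau> i t = (if t \<in> {0..\<tau>} then
    (case i of None \<Rightarrow> (0, sin (pi / \<tau> * t)) | Some n \<Rightarrow> (sin (pi * n / \<tau> * t), 0)) else 0)"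

definition Dirichlet_field :: "real \<Rightarrow> int set \<Rightarrow> (int \<Rightarrow> real) \<Rightarrow> real \<Rightarrow> real \<Rightarrow> real \<times> real"
  where "Dirichlet_field \<tau> I c d t = (if t \<in> {0..\<tau>} then
    (\<Sum>n\<in>I. c n * sin (pi * n / \<tau> * t), d * sin (pi / \<tau> * t)) else 0)"

definition Dirichlet_field_deriv :: "real \<Rightarrow> int set \<Rightarrow> (int \<Rightarrow> real) \<Rightarrow> real \<Rightarrow> real \<Rightarrow> real \<times> real"
  where "Dirichlet_field_deriv \<tau> I c d t =
    (\<Sum>n\<in>I. (pi * n / \<tau> * c n) * cos (pi * n / \<tau> * t), (pi / \<tau> * d) * cos (pi / \<tau> * t))"

lemma sum_Dirichlet_mode:
  assumes "finite I"
  shows "(\<Sum>i\<in>insert None (Some ` I). c i *\<^sub>R Dirichlet_mode \<tau> i)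
    = Dirichlet_field \<tau> I (\<lambda>n. c (Some n)) (c None)"
proof
  fix t
  show "(\<Sum>i\<in>insert None (Some ` I). c i *\<^sub>R Dirichlet_mode \<tau> i) t
      = Dirichlet_field \<tau> I (\<lambda>n. c (Some n)) (c None) t"
    unfolding sum_insert_None[OF assms] plus_fun_apply sum_fun_apply
  proof (cases "t \<in> {0..\<tau>}")
    case True
    then show "(c None *\<^sub>R Dirichlet_mode \<tau> None) t + (\<Sum>n\<in>I. (c (Some n) *\<^sub>R Dirichlet_mode \<tau> (Some n)) t)
        = Dirichlet_field \<tau> I (\<lambda>n. c (Some n)) (c None) t"
      by (simp add: Dirichlet_mode_def Dirichlet_field_def scaleR_fun_def fst_sum snd_sum prod_eq_iff)
  next
    case False
    then have "Dirichlet_mode \<tau> i t = 0" "Dirichlet_field \<tau> I (\<lambda>n. c (Some n)) (c None) t = 0" for i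
      by (simp_all only: Dirichlet_mode_def Dirichlet_field_def if_False)
    then show "(c None *\<^sub>R Dirichlet_mode \<tau> None) t + (\<Sum>n\<in>I. (c (Some n) *\<^sub>R Dirichlet_mode \<tau> (Some n)) t)
        = Dirichlet_field \<tau> I (\<lambda>n. c (Some n)) (c None) t"
      by (simp add: scaleR_fun_def)
  qed
qed

lemma DERIV_sin_scaled:
  "((\<lambda>t. a * sin (\<omega> * t)) has_real_derivative (\<omega> * a) * cos (\<omega> * t)) (at t)"
  by (auto intro!: derivative_eq_intros)

lemma has_H1_deriv_Dirichlet_field:
  "has_H1_deriv (Dirichlet_field \<tau> I c d) (Dirichlet_field_deriv \<tau> I c d) 0 \<tau>"
proof -
  have "has_H1_deriv (\<lambda>t. (\<Sum>n\<in>I. c n * sin (pi * n / \<tau> * t), d * sin (pi / \<tau> * t)))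
      (Dirichlet_field_deriv \<tau> I c d) 0 \<tau>"
    unfolding has_H1_deriv_components Dirichlet_field_deriv_def fst_conv snd_conv
    by (intro conjI has_H1_deriv_smooth DERIV_sum DERIV_sin_scaled continuous_on_sum
        continuous_on_mult_left continuous_on_cos continuous_on_id)
  then show ?thesis
    by (subst has_H1_deriv_cong) (auto simp: Dirichlet_field_def)
qed

lemma Dirichlet_field_in_H1_Dirichlet:
  assumes "0 < \<tau>"
  shows "Dirichlet_field \<tau> I c d \<in> H1_Dirichlet \<tau>"
proof -
  have "sin (pi * real_of_int n / \<tau> * \<tau>) = 0" for n
    using assms by (simp add: sin_zero_iff_int2)
  moreover have "sin (pi / \<tau> * \<tau>) = 0"
    using assms by simp
  ultimately have "Dirichlet_field \<tau> I c d \<tau> = 0"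
    unfolding Dirichlet_field_def by (simp add: zero_prod_def)
  then show ?thesis
    using has_H1_deriv_Dirichlet_field[of \<tau> I c d] unfolding H1_Dirichlet_def
    by (auto simp: Dirichlet_field_def zero_prod_def)
qed

lemma oscillator_form_Dirichlet_field:
  assumes "0 < \<tau>" "finite I" and pos: "\<And>n. n \<in> I \<Longrightarrow> 0 < n"
  shows "oscillator_form A B \<tau> (Dirichlet_field \<tau> I c d) (Dirichlet_field_deriv \<tau> I c d)
    = \<tau> / 2 * (\<Sum>n\<in>I. ((pi * n / \<tau>)\<^sup>2 - A\<^sup>2) * (c n)\<^sup>2) + \<tau> / 2 * ((pi / \<tau>)\<^sup>2 - B\<^sup>2) * d\<^sup>2"
proof -
  have "integral {0..\<tau>} (\<lambda>t. (fst (Dirichlet_field \<tau> I c d t))\<^sup>2)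
      = integral {0..\<tau>} (\<lambda>t. (\<Sum>n\<in>I. c n * sin (pi * n / \<tau> * t))\<^sup>2)"
    by (intro integral_cong) (simp add: Dirichlet_field_def)
  also have "\<dots> = \<tau> / 2 * (\<Sum>n\<in>I. (c n)\<^sup>2)"
    using assms
    by (intro integral_unique has_integral_orthogonal_sum_square has_integral_trig_half_period_mult)
  finally have x: "integral {0..\<tau>} (\<lambda>t. (fst (Dirichlet_field \<tau> I c d t))\<^sup>2) = \<tau> / 2 * (\<Sum>n\<in>I. (c n)\<^sup>2)" .
  have x': "integral {0..\<tau>} (\<lambda>t. (fst (Dirichlet_field_deriv \<tau> I c d t))\<^sup>2)
      = \<tau> / 2 * (\<Sum>n\<in>I. (pi * n / \<tau> * c n)\<^sup>2)"
    unfolding Dirichlet_field_deriv_def fst_conv using assms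
    by (intro integral_unique has_integral_orthogonal_sum_square has_integral_trig_half_period_mult)
  have sc: "((\<lambda>t. (sin (pi / \<tau> * t))\<^sup>2) has_integral \<tau> / 2) {0..\<tau>}"
    "((\<lambda>t. (cos (pi / \<tau> * t))\<^sup>2) has_integral \<tau> / 2) {0..\<tau>}"
    using has_integral_trig_half_period_mult[OF \<open>0 < \<tau>\<close>, of 1 1] by (auto simp: power2_eq_square)
  have "integral {0..\<tau>} (\<lambda>t. (snd (Dirichlet_field \<tau> I c d t))\<^sup>2)
      = integral {0..\<tau>} (\<lambda>t. d\<^sup>2 * (sin (pi / \<tau> * t))\<^sup>2)"
    by (intro integral_cong) (simp add: Dirichlet_field_def power_mult_distrib)
  also have "\<dots> = d\<^sup>2 * (\<tau> / 2)"
    by (intro integral_unique has_integral_mult_right sc)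
  finally have y: "integral {0..\<tau>} (\<lambda>t. (snd (Dirichlet_field \<tau> I c d t))\<^sup>2) = d\<^sup>2 * (\<tau> / 2)" .
  have y': "integral {0..\<tau>} (\<lambda>t. (snd (Dirichlet_field_deriv \<tau> I c d t))\<^sup>2) = (pi / \<tau> * d)\<^sup>2 * (\<tau> / 2)"
    unfolding Dirichlet_field_deriv_def snd_conv power_mult_distrib[of _ "cos _"]
    by (intro integral_unique has_integral_mult_right sc)
  have "\<tau> / 2 * (\<Sum>n\<in>I. (pi * n / \<tau> * c n)\<^sup>2) - A\<^sup>2 * (\<tau> / 2 * (\<Sum>n\<in>I. (c n)\<^sup>2))
      = \<tau> / 2 * ((\<Sum>n\<in>I. (pi * n / \<tau> * c n)\<^sup>2) - (\<Sum>n\<in>I. A\<^sup>2 * (c n)\<^sup>2))"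
    by (simp add: right_diff_distrib sum_distrib_left[symmetric])
  also have "\<dots> = \<tau> / 2 * (\<Sum>n\<in>I. ((pi * n / \<tau>)\<^sup>2 - A\<^sup>2) * (c n)\<^sup>2)"
    by (simp only: power_mult_distrib left_diff_distrib sum_subtractf)
  finally have x_part: "\<tau> / 2 * (\<Sum>n\<in>I. (pi * n / \<tau> * c n)\<^sup>2) - A\<^sup>2 * (\<tau> / 2 * (\<Sum>n\<in>I. (c n)\<^sup>2))
      = \<tau> / 2 * (\<Sum>n\<in>I. ((pi * n / \<tau>)\<^sup>2 - A\<^sup>2) * (c n)\<^sup>2)" .
  have y_part: "(pi / \<tau> * d)\<^sup>2 * (\<tau> / 2) - B\<^sup>2 * (d\<^sup>2 * (\<tau> / 2)) = \<tau> / 2 * ((pi / \<tau>)\<^sup>2 - B\<^sup>2) * d\<^sup>2"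
    unfolding power_mult_distrib[of "pi / \<tau>" d] by (simp add: left_diff_distrib right_diff_distrib mult.commute mult.left_commute)
  show ?thesis
    unfolding oscillator_form_def x x' y y' by (simp only: x_part y_part)
qed

lemma oscillator_form_Dirichlet_field_neg:
  assumes "0 < \<tau>" "finite I" "0 \<le> A" "B * \<tau> = 2 * pi"
    and pos: "\<And>n. n \<in> I \<Longrightarrow> 0 < n" and small: "\<And>n. n \<in> I \<Longrightarrow> pi * n < A * \<tau>"
    and nz: "d \<noteq> 0 \<or> (\<exists>n\<in>I. c n \<noteq> 0)"
  shows "oscillator_form A B \<tau> (Dirichlet_field \<tau> I c d) (Dirichlet_field_deriv \<tau> I c d) < 0"
proof -
  have q: "(pi * n / \<tau>)\<^sup>2 - A\<^sup>2 < 0" if "n \<in> I" for n :: int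
  proof -
    have "pi * n / \<tau> < A"
      using small[OF that] \<open>0 < \<tau>\<close> by (simp add: field_simps)
    then have "(pi * n / \<tau>)\<^sup>2 < A\<^sup>2"
      using pos[OF that] \<open>0 < \<tau>\<close> by (intro power_strict_mono) auto
    then show ?thesis by simp
  qed
  define X where "X = (\<Sum>n\<in>I. ((pi * n / \<tau>)\<^sup>2 - A\<^sup>2) * (c n)\<^sup>2)"
  \<comment> \<open>The half-wave sine has half the resonant frequency, whence the coefficient 1 - 4
    = -3 in units of (pi / \<tau>)^2.\<close>
  have "2 * (pi / \<tau>) = B"
    using assms by (simp add: field_simps)
  then have K: "(pi / \<tau>)\<^sup>2 - B\<^sup>2 = - (3 * (pi / \<tau>)\<^sup>2)"
    by (auto simp: power2_eq_square)
  have form: "oscillator_form A B \<tau> (Dirichlet_field \<tau> I c d) (Dirichlet_field_deriv \<tau> I c d)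
      = \<tau> / 2 * X - \<tau> / 2 * (3 * (pi / \<tau>)\<^sup>2) * d\<^sup>2"
    using oscillator_form_Dirichlet_field[OF assms(1,2) pos, of A B c d] unfolding K X_def by simp
  have X: "\<tau> / 2 * X \<le> 0"
    using mode_sum_neg(1)[OF \<open>finite I\<close> q] \<open>0 < \<tau>\<close> unfolding X_def
    by (intro mult_nonneg_nonpos) auto
  have D: "0 \<le> \<tau> / 2 * (3 * (pi / \<tau>)\<^sup>2) * d\<^sup>2"
    using \<open>0 < \<tau>\<close> by (intro mult_nonneg_nonneg) auto
  from nz show ?thesis
  proof
    assume "d \<noteq> 0"
    then have "0 < \<tau> / 2 * (3 * (pi / \<tau>)\<^sup>2) * d\<^sup>2"
      using \<open>0 < \<tau>\<close> by (intro mult_pos_pos) auto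
    then show ?thesis
      using X form by linarith
  next
    assume "\<exists>n\<in>I. c n \<noteq> 0"
    then obtain n where "n \<in> I" "c n \<noteq> 0"
      by blast
    then have "X < 0"
      unfolding X_def by (intro mode_sum_neg(2)[OF \<open>finite I\<close> q])
    then have "\<tau> / 2 * X < 0"
      using \<open>0 < \<tau>\<close> by (intro mult_pos_neg) auto
    then show ?thesis
      using D form by linarith
  qed
qed

section \<open>The indices of the vertical orbit\<close>

text \<open>
  The variation of the period couples only to the first vertical cosine mode, on which the
  fixed-period form vanishes. A small multiple of that mode therefore yields one more negative
  direction; \<open>\<alpha> = a / T\<close> (\<open>a\<close> the amplitude of the orbit) turns out to be small enough.
\<close>

definition free_period_mode :: "real \<Rightarrow> int option option \<Rightarrow> (real \<Rightarrow> real \<times> real) \<times> real"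
  where "free_period_mode \<alpha> i =
    (case i of None \<Rightarrow> (\<lambda>t. (0, \<alpha> * cos (2 * pi * t)), 1) | Some j \<Rightarrow> (periodic_mode 1 j, 0))"

lemma sum_free_period_mode:
  assumes "finite I"
  shows "(\<Sum>i\<in>insert None (Some ` insert None (Some ` I)). c i *\<^sub>R free_period_mode \<alpha> i)
    = (periodic_field 1 I (\<lambda>n. c (Some (Some n))) (c (Some None)) (c None * \<alpha>), c None)"
proof -
  let ?J = "insert None (Some ` I)"
  have "(\<Sum>j\<in>?J. c (Some j) *\<^sub>R free_period_mode \<alpha> (Some j))
      = (\<Sum>j\<in>?J. c (Some j) *\<^sub>R periodic_mode 1 j, 0)"
    by (simp add: free_period_mode_def prod_eq_iff fst_sum snd_sum)
  also have "\<dots> = (periodic_field 1 I (\<lambda>n. c (Some (Some n))) (c (Some None)) 0, 0)"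
    by (simp only: sum_periodic_mode[OF assms, of "\<lambda>j. c (Some j)"])
  finally have "(\<Sum>i\<in>insert None (Some ` ?J). c i *\<^sub>R free_period_mode \<alpha> i)
      = c None *\<^sub>R free_period_mode \<alpha> None + (periodic_field 1 I (\<lambda>n. c (Some (Some n))) (c (Some None)) 0, 0)"
    using assms by (subst sum_insert_None) simp_all
  also have "\<dots> = (periodic_field 1 I (\<lambda>n. c (Some (Some n))) (c (Some None)) (c None * \<alpha>), c None)"
    by (simp add: free_period_mode_def periodic_field_def scaleR_fun_def fun_eq_iff)
  finally show ?thesis .
qed

lemma card_insert_None:
  assumes "finite I"
  shows "card (insert None (Some ` I)) = Suc (card I)"
  using assms by (subst card_insert_disjoint) (auto simp: card_image)

lemma has_H1_deriv_cosine:
  "has_H1_deriv (\<lambda>t. a * cos (\<omega> * t)) (\<lambda>t. a * - (\<omega> * sin (\<omega> * t))) 0 \<tau>"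
  by (intro has_H1_deriv_smooth DERIV_cos_scaled continuous_intros)

text \<open>The two inequalities say that \<open>m\<close> is the ceiling of 1 / \<mu>. The weak one
  feeds the 2 m conditions of the upper bound; the strict one makes all frequencies below m
  negative. These are 2 m - 1 horizontal modes, to which the vertical constant is added.\<close>

lemma fixed_time_index_vertical_orbit:
  fixes m :: nat
  assumes "\<mu> > 0" "m > 0" "1 / \<mu> \<le> real m" "real m - 1 < 1 / \<mu>"
  shows "fixed_time_index (oscillator_lagrangian \<mu>) (vertical_period \<mu>) (vertical_orbit \<mu> k) = enat (2 * m)"
proof -
  define \<tau> where "\<tau> = vertical_period \<mu>"
  have \<tau>: "0 < \<tau>" "1 * \<tau> = 2 * pi * (1 / \<mu>)" "\<mu> * \<tau> = 2 * pi"
    using \<open>\<mu> > 0\<close> by (auto simp: \<tau>_def vertical_period_def)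
  have upper: "1 * \<tau> \<le> real (2 * m) * pi"
  proof -
    have "2 * pi * (1 / \<mu>) \<le> 2 * pi * real m"
      using assms by (intro mult_left_mono) auto
    also have "\<dots> = real (2 * m) * pi"
      by simp
    finally show ?thesis
      unfolding \<tau>(2) .
  qed
  have lower: "2 * pi * (real m - 1) < 1 * \<tau>"
    unfolding \<tau> using assms by (intro mult_strict_left_mono) auto
  define Q where "Q = second_variation (action (oscillator_lagrangian \<mu>) \<tau>) (vertical_orbit \<mu> k)"
  have Q: "Q v = oscillator_form 1 \<mu> \<tau> v z" if "has_H1_deriv v z 0 \<tau>" for v z
    using second_variation_action[OF has_H1_deriv_cosine that] \<tau>(1)
    by (simp add: Q_def vertical_orbit_def[abs_def] continuous_intros)
  have "morse_index (H1_periodic \<tau>) Q \<le> enat (2 * m)"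
  proof (rule morse_index_le[where \<phi> = "alternation_defect m \<tau>"])
    show "linear (alternation_defect m \<tau> i)" for i
      by (rule linear_alternation_defect)
    fix v assume v: "v \<in> H1_periodic \<tau>" "\<And>i. i < 2 * m \<Longrightarrow> alternation_defect m \<tau> i v = 0"
    then obtain z where z: "has_H1_deriv v z 0 \<tau>"
      by (auto simp: H1_periodic_def)
    show "0 \<le> Q v"
      unfolding Q[OF z] using assms \<tau> upper v z by (intro oscillator_form_nonneg_periodic) auto
  qed
  moreover
  define I where "I = {- (int m - 1)..int m - 1}"
  have "finite I" by (simp add: I_def)
  have "enat (card (insert None (Some ` I))) \<le> morse_index (H1_periodic \<tau>) Q"
  proof (rule morse_index_ge[where e = "periodic_mode \<tau>"], unfold sum_periodic_mode[OF \<open>finite I\<close>])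
    show "finite (insert None (Some ` I))"
      using \<open>finite I\<close> by simp
    show "0 \<le> Q 0"
      by (simp add: Q_def second_variation_zero)
    show "periodic_field \<tau> I (\<lambda>n. c (Some n)) (c None) 0 \<in> H1_periodic \<tau>" for c
      using \<tau>(1) by (rule periodic_field_in_H1_periodic)
    fix c :: "int option \<Rightarrow> real" and j
    assume "j \<in> insert None (Some ` I)" "c j \<noteq> 0"
    then have "c None \<noteq> 0 \<or> (\<exists>n\<in>I. c (Some n) \<noteq> 0)"
      by auto
    then show "Q (periodic_field \<tau> I (\<lambda>n. c (Some n)) (c None) 0) < 0"
      unfolding Q[OF has_H1_deriv_periodic_field] I_def
      using \<tau> lower by (intro oscillator_form_periodic_field_bounds(2)) auto
  qed
  moreover have "card (insert None (Some ` I)) = 2 * m"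
    using \<open>finite I\<close> \<open>m > 0\<close>
    by (simp only: card_insert_None finite_insert finite_imageI) (simp add: I_def)
  ultimately show ?thesis
    by (simp add: fixed_time_index_def Q_def \<tau>_def antisym)
qed

text \<open>Dirichlet frequencies come in steps of pi / \<tau> instead of 2 pi / \<tau> and without
  multiplicity, so the threshold is 2 / \<mu> and each step counts once.\<close>

lemma Dirichlet_index_vertical_orbit:
  fixes m :: nat
  assumes "\<mu> > 0" "m > 0" "2 / \<mu> \<le> real m" "real m - 1 < 2 / \<mu>"
  shows "Dirichlet_index (oscillator_lagrangian \<mu>) (vertical_period \<mu>) (vertical_orbit \<mu> k) = enat m"
proof -
  define \<tau> where "\<tau> = vertical_period \<mu>"
  have \<tau>: "0 < \<tau>" "1 * \<tau> = pi * (2 / \<mu>)" "\<mu> * \<tau> = 2 * pi"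
    using \<open>\<mu> > 0\<close> by (auto simp: \<tau>_def vertical_period_def)
  have upper: "1 * \<tau> \<le> real m * pi"
  proof -
    have "pi * (2 / \<mu>) \<le> pi * real m"
      using assms by (intro mult_left_mono) auto
    then show ?thesis
      using \<tau> by (simp add: mult.commute)
  qed
  define Q where "Q = second_variation (action (oscillator_lagrangian \<mu>) \<tau>) (vertical_orbit \<mu> k)"
  have Q: "Q v = oscillator_form 1 \<mu> \<tau> v z" if "has_H1_deriv v z 0 \<tau>" for v z
    using second_variation_action[OF has_H1_deriv_cosine that] \<tau>(1)
    by (simp add: Q_def vertical_orbit_def[abs_def] continuous_intros)
  have "morse_index (H1_Dirichlet \<tau>) Q \<le> enat m"
  proof (rule morse_index_le[where \<phi> = "node_value m \<tau>"])
    show "linear (node_value m \<tau> i)" for i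
      by (rule linear_node_value)
    fix v assume v: "v \<in> H1_Dirichlet \<tau>" "\<And>i. i < m \<Longrightarrow> node_value m \<tau> i v = 0"
    then obtain z where z: "has_H1_deriv v z 0 \<tau>"
      by (auto simp: H1_Dirichlet_def)
    show "0 \<le> Q v"
      unfolding Q[OF z] using assms \<tau> upper v z by (intro oscillator_form_nonneg_Dirichlet) auto
  qed
  moreover
  \<comment> \<open>For m = 1 this set is empty and only the vertical half-wave is left.\<close>
  define I where "I = {1..int m - 1}"
  have "finite I" by (simp add: I_def)
  have "enat (card (insert None (Some ` I))) \<le> morse_index (H1_Dirichlet \<tau>) Q"
  proof (rule morse_index_ge[where e = "Dirichlet_mode \<tau>"], unfold sum_Dirichlet_mode[OF \<open>finite I\<close>])
    show "finite (insert None (Some ` I))"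
      using \<open>finite I\<close> by simp
    show "0 \<le> Q 0"
      by (simp add: Q_def second_variation_zero)
    show "Dirichlet_field \<tau> I (\<lambda>n. c (Some n)) (c None) \<in> H1_Dirichlet \<tau>" for c
      using \<tau>(1) by (rule Dirichlet_field_in_H1_Dirichlet)
    fix c :: "int option \<Rightarrow> real" and j
    assume "j \<in> insert None (Some ` I)" "c j \<noteq> 0"
    then have nz: "c None \<noteq> 0 \<or> (\<exists>n\<in>I. c (Some n) \<noteq> 0)"
      by auto
    have "pi * n < 1 * \<tau>" if "n \<in> I" for n :: int
    proof -
      have "real_of_int n < 2 / \<mu>"
        using that assms unfolding I_def by auto
      then show ?thesis
        unfolding \<tau> by (intro mult_strict_left_mono) auto
    qed
    then show "Q (Dirichlet_field \<tau> I (\<lambda>n. c (Some n)) (c None)) < 0"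
      unfolding Q[OF has_H1_deriv_Dirichlet_field]
      using \<tau> nz \<open>finite I\<close> by (intro oscillator_form_Dirichlet_field_neg) (auto simp: I_def)
  qed
  moreover have "card (insert None (Some ` I)) = m"
    using \<open>finite I\<close> \<open>m > 0\<close>
    by (simp only: card_insert_None finite_insert finite_imageI) (simp add: I_def)
  ultimately show ?thesis
    by (simp add: Dirichlet_index_def Q_def \<tau>_def antisym)
qed

text \<open>On the plane of the first vertical cosine and the period, the Hessian has diagonal
  entries 0 and a^2 \<mu>^2 / (2 T) and off-diagonal entry - a \<mu>^2. It is indefinite because a >
  0, so exactly one negative direction is gained over the fixed-time index.\<close>

lemma free_period_index_vertical_orbit:
  fixes m :: nat
  assumes "\<mu> > 0" "k > 0" "m > 0" "1 / \<mu> \<le> real m" "real m - 1 < 1 / \<mu>"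
  shows "free_period_index (oscillator_lagrangian \<mu>) k (vertical_period \<mu>) (vertical_orbit \<mu> k)
    = enat (2 * m + 1)"
proof -
  define T where "T = vertical_period \<mu>"
  have T: "0 < T" "T = 2 * pi * (1 / \<mu>)" "T * \<mu> = 2 * pi"
    using \<open>\<mu> > 0\<close> by (auto simp: T_def vertical_period_def)
  define a where "a = vertical_amplitude \<mu> k"
  have "a > 0"
    using assms by (simp add: a_def vertical_amplitude_def)
  define g where "g t = a * cos (2 * pi * t)" for t
  define g' where "g' t = a * - (2 * pi * sin (2 * pi * t))" for t
  have angle: "\<mu> * (T * s) = 2 * pi * s" for s
    unfolding T(3)[symmetric] by (simp only: ac_simps)
  have orbit: "(\<lambda>s. vertical_orbit \<mu> k (T * s)) = (\<lambda>t. (0, g t))"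
    unfolding vertical_orbit_def g_def a_def angle ..
  have g: "has_H1_deriv g g' 0 1" and cg': "continuous_on {0..1} g'"
    unfolding g_def g'_def by (rule has_H1_deriv_cosine, intro continuous_intros)
  have upper: "T * 1 \<le> real (2 * m) * pi"
  proof -
    have "2 * pi * (1 / \<mu>) \<le> 2 * pi * real m"
      using assms by (intro mult_left_mono) auto
    also have "\<dots> = real (2 * m) * pi"
      by simp
    finally show ?thesis
      unfolding T(2) mult_1_right .
  qed
  have lower: "2 * pi * (real m - 1) < T * 1"
    unfolding mult_1_right T(2) using assms by (intro mult_strict_left_mono) auto
  define Q where "Q = second_variation (free_period_action (oscillator_lagrangian \<mu>) k)
    (\<lambda>s. vertical_orbit \<mu> k (T * s), T)"
  have Q: "Q (v, b) = oscillator_form T (2 * pi) 1 v z / T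
      - 2 * b * (integral {0..1} (\<lambda>t. g' t * snd (z t)) / T\<^sup>2 + \<mu>\<^sup>2 * integral {0..1} (\<lambda>t. g t * snd (v t)))
      + b\<^sup>2 * integral {0..1} (\<lambda>t. (g' t)\<^sup>2) / T^3" if "has_H1_deriv v z 0 1" for v z b
    unfolding Q_def orbit second_variation_free_period_action[OF g that cg' T(1)] T(3) ..
  \<comment> \<open>The functional with index 2 m is the period component. On its kernel the
    coupling terms disappear and the fixed-period form, divided by T, remains.\<close>
  have "morse_index (H1_periodic 1 \<times> UNIV) Q \<le> enat (2 * m + 1)"
  proof (rule morse_index_le[where \<phi> = "\<lambda>i v. if i < 2 * m then alternation_defect m 1 i (fst v) else snd v"])
    show "linear (\<lambda>v. if i < 2 * m then alternation_defect m 1 i (fst v) else snd v)" for i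
      by (rule linearI) (simp_all add: linear_add linear_scale linear_alternation_defect)
    fix v assume v: "v \<in> H1_periodic 1 \<times> (UNIV :: real set)"
      and zero: "\<And>i. i < 2 * m + 1 \<Longrightarrow> (if i < 2 * m then alternation_defect m 1 i (fst v) else snd v) = 0"
    obtain u where u: "v = (u, 0)" "u \<in> H1_periodic 1"
      using v zero[of "2 * m"] by (cases v) auto
    then obtain z where z: "has_H1_deriv u z 0 1"
      by (auto simp: H1_periodic_def)
    have "alternation_defect m 1 i u = 0" if "i < 2 * m" for i
      using zero[of i] that u by simp
    then have "0 \<le> oscillator_form T (2 * pi) 1 u z"
      using assms T upper u z by (intro oscillator_form_nonneg_periodic) auto
    then show "0 \<le> Q v"
      unfolding u Q[OF z] using T(1) by simp
  qed
  moreover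
  define I where "I = {- (int m - 1)..int m - 1}"
  have "finite I" by (simp add: I_def)
  let ?J = "insert None (Some ` insert None (Some ` I))"
  \<comment> \<open>With a multiple \<alpha> of the cosine per unit of period, the terms outside the
    fixed-period form add up to r^2 a \<mu>^2 (a / (2 T) - 2 \<alpha>), negative once \<alpha> > a /
    (4 T). The choice \<alpha> = a / T yields the factor - 3 / 2. The vertical constant
    \<open>d\<close> is orthogonal to the orbit and does not contribute to the coupling.\<close>
  have neg: "Q (periodic_field 1 I c d (r * (a / T)), r)
      = oscillator_form T (2 * pi) 1 (periodic_field 1 I c d (r * (a / T))) (periodic_field_deriv 1 I c (r * (a / T))) / T
        - 3 / 2 * (r * a * \<mu>)\<^sup>2 / T" for c d r
  proof -
    note cs = has_integral_cos_square[of 1, simplified]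
    have one: "integral {0..1} (\<lambda>t. (g' t)\<^sup>2) = a\<^sup>2 * (2 * pi)\<^sup>2 * (1 / 2)"
    proof (rule integral_unique)
      have "((\<lambda>t. a\<^sup>2 * (2 * pi)\<^sup>2 * (sin (2 * pi * t))\<^sup>2) has_integral a\<^sup>2 * (2 * pi)\<^sup>2 * (1 / 2)) {0..1}"
        by (intro has_integral_mult_right cs)
      then show "((\<lambda>t. (g' t)\<^sup>2) has_integral a\<^sup>2 * (2 * pi)\<^sup>2 * (1 / 2)) {0..1}"
        by (simp add: g'_def power_mult_distrib mult.assoc)
    qed
    have two: "integral {0..1} (\<lambda>t. g' t * snd (periodic_field_deriv 1 I c (r * (a / T)) t))
        = a * (r * (a / T)) * (2 * pi)\<^sup>2 * (1 / 2)"
    proof (rule integral_unique)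
      have "((\<lambda>t. a * (r * (a / T)) * (2 * pi)\<^sup>2 * (sin (2 * pi * t))\<^sup>2) has_integral
          a * (r * (a / T)) * (2 * pi)\<^sup>2 * (1 / 2)) {0..1}"
        by (intro has_integral_mult_right cs)
      then show "((\<lambda>t. g' t * snd (periodic_field_deriv 1 I c (r * (a / T)) t)) has_integral
          a * (r * (a / T)) * (2 * pi)\<^sup>2 * (1 / 2)) {0..1}"
        by (rule has_integral_eq[rotated]) (simp add: g'_def periodic_field_deriv_def power2_eq_square)
    qed
    have three: "integral {0..1} (\<lambda>t. g t * snd (periodic_field 1 I c d (r * (a / T)) t))
        = a * d * 0 + a * (r * (a / T)) * (1 / 2)"
    proof (rule integral_unique)
      have "((\<lambda>t. a * d * cos (2 * pi * t) + a * (r * (a / T)) * (cos (2 * pi * t))\<^sup>2) has_integral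
          a * d * 0 + a * (r * (a / T)) * (1 / 2)) {0..1}"
        by (intro has_integral_add has_integral_mult_right cs)
      then show "((\<lambda>t. g t * snd (periodic_field 1 I c d (r * (a / T)) t)) has_integral
          a * d * 0 + a * (r * (a / T)) * (1 / 2)) {0..1}"
        by (rule has_integral_eq[rotated]) (simp add: g_def periodic_field_def power2_eq_square algebra_simps)
    qed
    have "a * (r * (a / T)) * (T * \<mu>)\<^sup>2 * (1 / 2) / T\<^sup>2 = r * a\<^sup>2 * \<mu>\<^sup>2 / (2 * T)"
      "\<mu>\<^sup>2 * (a * d * 0 + a * (r * (a / T)) * (1 / 2)) = r * a\<^sup>2 * \<mu>\<^sup>2 / (2 * T)"
      "r\<^sup>2 * (a\<^sup>2 * (T * \<mu>)\<^sup>2 * (1 / 2)) / T^3 = r\<^sup>2 * a\<^sup>2 * \<mu>\<^sup>2 / (2 * T)"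
      using T(1) by (simp_all add: power2_eq_square power3_eq_cube ac_simps)
    then have "- (2 * r * (a * (r * (a / T)) * (T * \<mu>)\<^sup>2 * (1 / 2) / T\<^sup>2 + \<mu>\<^sup>2 * (a * d * 0 + a * (r * (a / T)) * (1 / 2))))
        + r\<^sup>2 * (a\<^sup>2 * (T * \<mu>)\<^sup>2 * (1 / 2)) / T^3
        = - (2 * r * (r * a\<^sup>2 * \<mu>\<^sup>2 / (2 * T) + r * a\<^sup>2 * \<mu>\<^sup>2 / (2 * T))) + r\<^sup>2 * a\<^sup>2 * \<mu>\<^sup>2 / (2 * T)"
      by (simp only:)
    also have "\<dots> = - (3 / 2 * (r * a * \<mu>)\<^sup>2 / T)"
      using T(1) by (simp add: field_simps power2_eq_square)
    finally show ?thesis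
      unfolding Q[OF has_H1_deriv_periodic_field] one two three T(3) by linarith
  qed
  have "enat (card ?J) \<le> morse_index (H1_periodic 1 \<times> UNIV) Q"
  proof (rule morse_index_ge[where e = "free_period_mode (a / T)"], unfold sum_free_period_mode[OF \<open>finite I\<close>])
    show "finite ?J"
      using \<open>finite I\<close> by simp
    show "0 \<le> Q 0"
      by (simp add: Q_def second_variation_zero)
    show "(periodic_field 1 I (\<lambda>n. c (Some (Some n))) (c (Some None)) (c None * (a / T)), c None)
        \<in> H1_periodic 1 \<times> UNIV" for c :: "int option option \<Rightarrow> real"
      by (simp add: periodic_field_in_H1_periodic)
    fix c :: "int option option \<Rightarrow> real" and j
    assume "j \<in> ?J" "c j \<noteq> 0"
    then have nz: "c None \<noteq> 0 \<or> (c (Some None) \<noteq> 0 \<or> (\<exists>n\<in>I. c (Some (Some n)) \<noteq> 0))"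
      by auto
    define F where "F = oscillator_form T (2 * pi) 1
        (periodic_field 1 I (\<lambda>n. c (Some (Some n))) (c (Some None)) (c None * (a / T)))
        (periodic_field_deriv 1 I (\<lambda>n. c (Some (Some n))) (c None * (a / T)))"
    have F: "F \<le> 0" "c (Some None) \<noteq> 0 \<or> (\<exists>n\<in>I. c (Some (Some n)) \<noteq> 0) \<Longrightarrow> F < 0"
      using oscillator_form_periodic_field_bounds[of 1 T "2 * pi" m] T(1) lower
      unfolding F_def I_def by auto
    have "F - 3 / 2 * (c None * a * \<mu>)\<^sup>2 < 0"
      using nz
    proof
      assume "c None \<noteq> 0"
      then have "0 < (c None * a * \<mu>)\<^sup>2"
        using \<open>a > 0\<close> \<open>\<mu> > 0\<close> by simp
      then show ?thesis
        using F(1) by linarith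
    next
      assume "c (Some None) \<noteq> 0 \<or> (\<exists>n\<in>I. c (Some (Some n)) \<noteq> 0)"
      moreover have "0 \<le> (c None * a * \<mu>)\<^sup>2"
        by simp
      ultimately show ?thesis
        using F(2) by linarith
    qed
    then have "(F - 3 / 2 * (c None * a * \<mu>)\<^sup>2) / T < 0"
      using T(1) by (rule divide_neg_pos)
    then show "Q (periodic_field 1 I (\<lambda>n. c (Some (Some n))) (c (Some None)) (c None * (a / T)), c None) < 0"
      unfolding neg F_def[symmetric] by (simp only: diff_divide_distrib)
  qed
  moreover have "card ?J = 2 * m + 1"
    using \<open>finite I\<close> \<open>m > 0\<close>
    by (simp only: card_insert_None finite_insert finite_imageI) (simp add: I_def)
  ultimately show ?thesis
    by (simp add: free_period_index_def Q_def T_def antisym)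
qed

theorem mainTheorem5:
  fixes \<mu> k :: real
  assumes "\<mu> > 0" and "k > 0"
  shows "fixed_time_index (oscillator_lagrangian \<mu>) (vertical_period \<mu>) (vertical_orbit \<mu> k)
           = enat (nat (2 * \<lceil>1 / \<mu>\<rceil>))
       \<and> free_period_index (oscillator_lagrangian \<mu>) k (vertical_period \<mu>) (vertical_orbit \<mu> k)
           = enat (nat (2 * \<lceil>1 / \<mu>\<rceil> + 1))
       \<and> Dirichlet_index (oscillator_lagrangian \<mu>) (vertical_period \<mu>) (vertical_orbit \<mu> k)
           = enat (nat \<lceil>2 / \<mu>\<rceil>)"
proof -
  \<comment> \<open>Positivity of the ceiling makes the conversion to \<open>nat\<close> lossless
    and provides a positive number of nodes.\<close>
  have ceil: "nat \<lceil>x\<rceil> > 0 \<and> x \<le> real (nat \<lceil>x\<rceil>) \<and> real (nat \<lceil>x\<rceil>) - 1 < x" if "x > 0" for x :: real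
  proof -
    have "\<lceil>x\<rceil> > 0"
      using that by simp
    then show ?thesis
      using ceiling_correct[of x] by simp
  qed
  have "\<lceil>1 / \<mu>\<rceil> > 0"
    using \<open>\<mu> > 0\<close> by simp
  then have "nat (2 * \<lceil>1 / \<mu>\<rceil>) = 2 * nat \<lceil>1 / \<mu>\<rceil>" "nat (2 * \<lceil>1 / \<mu>\<rceil> + 1) = 2 * nat \<lceil>1 / \<mu>\<rceil> + 1"
    by linarith+
  then show ?thesis
    using ceil[of "1 / \<mu>"] ceil[of "2 / \<mu>"] assms
      fixed_time_index_vertical_orbit[of \<mu> "nat \<lceil>1 / \<mu>\<rceil>" k]
      free_period_index_vertical_orbit[of \<mu> k "nat \<lceil>1 / \<mu>\<rceil>"]
      Dirichlet_index_vertical_orbit[of \<mu> "nat \<lceil>2 / \<mu>\<rceil>" k]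
    by auto
qed

end
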